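(* For $w\in\mathbb{N}_0$ let $\mathcal S_w$ be the set of all $p\in\mathcal P^{\circ\bullet}_{2,\mathrm{nb}}$ such that $\sigma_p(S)\in w\mathbb Z$ for every sector $S$ of $p$ (equivalently: when $p$ is rotated to one line, each block contains exactly one white and one black point, and between the two legs of any block the difference of the numbers of black and white points is a multiple of $w$). Then: (a) For every $w\in\mathbb N_0$, $\mathcal S_w$ is a category of two-colored partitions. (b) The sets $\mathcal S_w$, $w\in\mathbb N_0$, are pairwise distinct; for every $w\in\mathbb N$ one has $\mathcal S_0=\bigcap_{w'\in\mathbb N}\mathcal S_{w'}\subseteq\mathcal S_w\subseteq\mathcal S_1=\langle X\rangle$, where $X$ is the crossing partition; and for all $w,w'\in\mathbb N$, $w'\mathbb Z\subseteq w\mathbb Z$ implies $\mathcal S_{w'}\subseteq\mathcal S_w$. (c) For every $w\in\mathbb N$, $\mathcal S_w=\langle \mathrm{Br}(\bullet\mid \mathrm{Id}(\circ^{\otimes w})\mid\circ)\rangle$, and $\mathcal S_0=\langle H_{\circ\bullet\circ},\ \mathrm{Br}(\bullet\mid\mathrm{Id}(\bullet^{\otimes v}\circ^{\otimes v})\mid\circ)\ :\ v\in\mathbb N\rangle$.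
   Context: A two-colored partition consists of finitely many points split into a lower and an upper row, each totally ordered left to right, each point colored white ($\circ$) or black ($\bullet$) (inverse colors: $\overline\circ=\bullet$, $\overline\bullet=\circ$), together with a partition of the points into blocks; it is a pair partition if all blocks have two points. Operations: tensor product $p\otimes q$ (horizontal juxtaposition, $q$ to the right); involution $p^*$ (swap rows); composition $pq$, defined if the upper row of $p$ and the lower row of $q$ agree in length and coloring: identify these rows, $pq$ has the lower row of $p$ and the upper row of $q$, and remaining points are in one block iff connected by a chain of blocks of $p$ and $q$ (closed components in the middle are discarded). A category of partitions is a set closed under $\otimes$, $*$ and composition containing the two identity partitions (one lower and one upper point of equal color forming a block) and the two partitions with empty upper row whose lower row is $\bullet\circ$, resp. $\circ\bullet$, forming one block; $\langle\mathcal G\rangle$ is the smallest category containing $\mathcal G$. Cyclic order on all points of $p$: traverse the lower row left to right, then the upper row right to left, then back to the leftmost lower point. The normalized color of a lower point is its color, of an upper point the inverse of its color. For a set $S$ of points, $\sigma_p(S)$ is the number of points of $S$ of normalized color $\bullet$ minus the number of normalized color $\circ$; $S$ is neutral if $\sigma_p(S)=0$. $\mathcal P^{\circ\bullet}_{2,\mathrm{nb}}$ is the set of pair partitions all of whose blocks are neutral. For a proper subset $S$ of the points which is an interval of the cyclic order with at least two points, $\partial S$ is the set of its first and last point; $S$ is a sector if $\partial S$ is a block of $p$. The crossing partition $X$ has lower row $\circ\circ$, upper row $\circ\circ$, blocks $\{$lower 1, upper 2$\}$, $\{$lower 2, upper 1$\}$. $H_{\circ\bullet\circ}$ has lower and upper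 rows both colored $\circ\bullet\circ$ and blocks $\{$lower $i$, upper $4-i\}$, $i=1,2,3$. For colors $c_1,\dots,c_n$, $\mathrm{Id}(c_1\cdots c_n)$ is the tensor product of identity partitions with both rows colored $c_1\cdots c_n$ and blocks $\{$lower $i$, upper $i\}$; $c^{\otimes k}$ denotes $k$ copies of $c$. For a pair partition $a$ with $a=a^*$ and $aa=a$ and a color $c$, $\mathrm{Br}(c\mid a\mid\overline c)$ is the partition whose lower row is $c$, the lower row of $a$, $\overline c$, whose upper row is $c$, the upper row of $a$, $\overline c$, with blocks those of $a$ together with $\{$leftmost lower, rightmost lower$\}$ and $\{$leftmost upper, rightmost upper$\}$. *)

theory Defs
  imports Main "HOL-Library.Disjoint_Sets"
begin

datatype color = White | Black

primrec inv_color :: "color \<Rightarrow> color" where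
  "inv_color White = Black"
| "inv_color Black = White"

text \<open>Points of the lower and upper row, numbered from 0, left to right.\<close>

datatype point = Lo nat | Up nat

text \<open>A diagram is determined by its coloring and its blocks alone, so equality of
  two-colored partitions is equality of diagrams.\<close>

datatype diagram = Diagram (lower: "color list") (upper: "color list") (blocks: "point set set")

definition points :: "diagram \<Rightarrow> point set" where
  "points p = Lo ` {..<length (lower p)} \<union> Up ` {..<length (upper p)}"

definition two_colored_partition :: "diagram \<Rightarrow> bool" where
  "two_colored_partition p \<longleftrightarrow> partition_on (points p) (blocks p)"

definition pair_partition :: "diagram \<Rightarrow> bool" where
  "pair_partition p \<longleftrightarrow> two_colored_partition p \<and> (\<forall>B\<in>blocks p. card B = 2)"

primrec shift :: "nat \<Rightarrow> nat \<Rightarrow> point \<Rightarrow> point" where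
  "shift k l (Lo i) = Lo (k + i)"
| "shift k l (Up i) = Up (l + i)"

definition tensor :: "diagram \<Rightarrow> diagram \<Rightarrow> diagram" where
  "tensor p q = Diagram (lower p @ lower q) (upper p @ upper q)
     (blocks p \<union> (`) (shift (length (lower p)) (length (upper p))) ` blocks q)"

primrec swap_row :: "point \<Rightarrow> point" where
  "swap_row (Lo i) = Up i"
| "swap_row (Up i) = Lo i"

definition involution :: "diagram \<Rightarrow> diagram" where
  "involution p = Diagram (upper p) (lower p) ((`) swap_row ` blocks p)"

text \<open>Three rows for stacking: for the composition \<open>p q\<close>, the diagram \<open>p\<close> occupies the
  bottom and middle rows and \<open>q\<close> the middle and top rows.\<close>

datatype stacked_point = Bot nat | Mid nat | Top nat

primrec stack_first :: "point \<Rightarrow> stacked_point" where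
  "stack_first (Lo i) = Bot i"
| "stack_first (Up i) = Mid i"

primrec stack_second :: "point \<Rightarrow> stacked_point" where
  "stack_second (Lo i) = Mid i"
| "stack_second (Up i) = Top i"

primrec stack_outer :: "point \<Rightarrow> stacked_point" where
  "stack_outer (Lo i) = Bot i"
| "stack_outer (Up i) = Top i"

definition stack_link :: "diagram \<Rightarrow> diagram \<Rightarrow> (stacked_point \<times> stacked_point) set" where
  "stack_link p q = {(x, y). \<exists>B \<in> (`) stack_first ` blocks p \<union> (`) stack_second ` blocks q.
     x \<in> B \<and> y \<in> B}"

definition composable :: "diagram \<Rightarrow> diagram \<Rightarrow> bool" where
  "composable p q \<longleftrightarrow> upper p = lower q"

text \<open>Only meaningful for composable arguments.\<close>

definition compose :: "diagram \<Rightarrow> diagram \<Rightarrow> diagram" where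
  "compose p q = Diagram (lower p) (upper q)
     (let P = Lo ` {..<length (lower p)} \<union> Up ` {..<length (upper q)}
      in P // {(x, y) \<in> P \<times> P. (stack_outer x, stack_outer y) \<in> (stack_link p q)\<^sup>*})"

definition Id_part :: "color list \<Rightarrow> diagram" where
  "Id_part cs = Diagram cs cs {{Lo i, Up i} | i. i < length cs}"

definition category :: "diagram set \<Rightarrow> bool" where
  "category C \<longleftrightarrow>
     (\<forall>p\<in>C. two_colored_partition p) \<and>
     Id_part [White] \<in> C \<and> Id_part [Black] \<in> C \<and>
     Diagram [Black, White] [] {{Lo 0, Lo 1}} \<in> C \<and>
     Diagram [White, Black] [] {{Lo 0, Lo 1}} \<in> C \<and>
     (\<forall>p\<in>C. \<forall>q\<in>C. tensor p q \<in> C) \<and>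
     (\<forall>p\<in>C. involution p \<in> C) \<and>
     (\<forall>p\<in>C. \<forall>q\<in>C. composable p q \<longrightarrow> compose p q \<in> C)"

definition generated_category :: "diagram set \<Rightarrow> diagram set" where
  "generated_category G = \<Inter>{C. category C \<and> G \<subseteq> C}"

text \<open>All points of a diagram in cyclic order, starting at the leftmost lower point.\<close>

definition cyclic_points :: "diagram \<Rightarrow> point list" where
  "cyclic_points p = map Lo [0..<length (lower p)] @ map Up (rev [0..<length (upper p)])"

primrec normalized_color :: "diagram \<Rightarrow> point \<Rightarrow> color" where
  "normalized_color p (Lo i) = lower p ! i"
| "normalized_color p (Up i) = inv_color (upper p ! i)"

definition color_sum :: "diagram \<Rightarrow> point set \<Rightarrow> int" where
  "color_sum p S = int (card {x\<in>S. normalized_color p x = Black})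
                 - int (card {x\<in>S. normalized_color p x = White})"

definition neutral :: "diagram \<Rightarrow> point set \<Rightarrow> bool" where
  "neutral p S \<longleftrightarrow> color_sum p S = 0"

definition P2nb :: "diagram set" where
  "P2nb = {p. pair_partition p \<and> (\<forall>B\<in>blocks p. neutral p B)}"

text \<open>Intervals of the cyclic order are represented by the list of their points, from first
  to last.\<close>

definition cyclic_interval :: "diagram \<Rightarrow> point list \<Rightarrow> bool" where
  "cyclic_interval p xs \<longleftrightarrow> (\<exists>a m. xs = take m (rotate a (cyclic_points p)))"

definition sector :: "diagram \<Rightarrow> point set \<Rightarrow> bool" where
  "sector p S \<longleftrightarrow> S \<subset> points p \<and> 2 \<le> card S \<and>
     (\<exists>xs. cyclic_interval p xs \<and> S = set xs \<and> {hd xs, last xs} \<in> blocks p)"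

definition int_multiples :: "nat \<Rightarrow> int set" where
  "int_multiples w = {int w * z | z. True}"

definition S_cat :: "nat \<Rightarrow> diagram set" where
  "S_cat w = {p \<in> P2nb. \<forall>S. sector p S \<longrightarrow> color_sum p S \<in> int_multiples w}"

definition crossing :: diagram where
  "crossing = Diagram [White, White] [White, White] {{Lo 0, Up 1}, {Lo 1, Up 0}}"

definition H_part :: diagram where
  "H_part = Diagram [White, Black, White] [White, Black, White]
     {{Lo 0, Up 2}, {Lo 1, Up 1}, {Lo 2, Up 0}}"

text \<open>\<open>Br c a\<close> is $\mathrm{Br}(c \mid a \mid \overline{c})$. It is intended for pair
  partitions \<open>a\<close> with \<open>involution a = a\<close> and \<open>compose a a = a\<close>, for instance \<open>Id_part cs\<close>.\<close>

definition Br :: "color \<Rightarrow> diagram \<Rightarrow> diagram" where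
  "Br c a = Diagram (c # lower a @ [inv_color c]) (c # upper a @ [inv_color c])
     ((`) (shift 1 1) ` blocks a \<union>
      {{Lo 0, Lo (length (lower a) + 1)}, {Up 0, Up (length (upper a) + 1)}})"

end

theory Submission
  imports Defs
begin

text \<open>
  Label the blocks of a neutral pair partition and read each row as a word, a black point labelled
  \<open>a\<close> being \<open>a\<close> and a white one \<open>a\<inverse>\<close>. The diagrams of a category, under all labellings
  (distinct blocks may share labels), then form a congruence on words with \<open>a a\<inverse> \<approx> 1 \<approx> a\<inverse> a\<close>, that is,
  they define a group, and a diagram is in the category iff the word of its boundary, with distinct
  labels for its blocks, is trivial.

  For (a), label the points by their level modulo \<open>w\<close> in the lattice path of the boundary word: \<open>\<S>\<^sub>w\<close>
  consists of the diagrams whose blocks join points of equal level and opposite normalized color.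

  For (c), the bracket generators say that \<open>a v a\<inverse> = b v b\<inverse>\<close> for certain words \<open>v\<close>. Words \<open>v\<close> with
  this property form the centralizer of all \<open>b\<inverse> a\<close>, which in either case turns out to contain all words whose
  balance is a multiple of \<open>w\<close>. In a boundary word of \<open>\<S>\<^sub>w\<close> every label can therefore be
  replaced by one fixed letter \<open>e\<close>, leaving \<open>e\<^bsup>0\<^esup> = 1\<close>.
\<close>

subsection \<open>Labelled diagrams\<close>

type_synonym 'n letter = "'n \<times> color"

definition inv_letter :: "'n letter \<Rightarrow> 'n letter" where
  "inv_letter x = (fst x, inv_color (snd x))"

definition inv_word :: "'n letter list \<Rightarrow> 'n letter list" where
  "inv_word u = rev (map inv_letter u)"

text \<open>Inverting the upper letters makes the reading of the boundary in cyclic order the word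
  \<open>l @ inv_word u\<close>, and the color of a letter the normalized color of its
  point.\<close>

primrec letter_at :: "'n letter list \<Rightarrow> 'n letter list \<Rightarrow> point \<Rightarrow> 'n letter" where
  "letter_at l u (Lo i) = l ! i"
| "letter_at l u (Up i) = inv_letter (u ! i)"

text \<open>As no letter is its own inverse, the last condition forces every block to be a neutral
  pair. Different blocks may share a name.\<close>

definition labelling :: "'n letter list \<Rightarrow> 'n letter list \<Rightarrow> diagram \<Rightarrow> bool" where
  "labelling l u p \<longleftrightarrow> two_colored_partition p \<and> map snd l = lower p \<and> map snd u = upper p \<and>
     (\<forall>B\<in>blocks p. \<exists>x y. B = {x, y} \<and> letter_at l u y = inv_letter (letter_at l u x))"

lemma inv_color_inv_color [simp]: "inv_color (inv_color c) = c"
  by (cases c) auto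

lemma inv_color_neq [simp]: "inv_color c \<noteq> c" "c \<noteq> inv_color c"
  by (cases c; simp)+

lemma inv_color_eq_iff [simp]: "inv_color c = inv_color d \<longleftrightarrow> c = d"
  by (cases c; cases d) auto

lemma inv_letter_simps [simp]:
  "inv_letter (inv_letter x) = x" "fst (inv_letter x) = fst x"
  "snd (inv_letter x) = inv_color (snd x)" "inv_letter (n, c) = (n, inv_color c)"
  by (auto simp: inv_letter_def)

lemma inv_letter_neq [simp]: "inv_letter x \<noteq> x" "x \<noteq> inv_letter x"
  by (cases x; simp)+

lemma inv_word_simps [simp]:
  "inv_word [] = []" "inv_word (x # u) = inv_word u @ [inv_letter x]"
  "inv_word (u @ v) = inv_word v @ inv_word u" "inv_word (inv_word u) = u"
  by (auto simp: inv_word_def rev_map map_idI)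

lemma labellingD:
  assumes "labelling l u p"
  shows "partition_on (points p) (blocks p)" "lower p = map snd l" "upper p = map snd u"
    "length (lower p) = length l" "length (upper p) = length u"
    "points p = Lo ` {..<length l} \<union> Up ` {..<length u}"
  using assms by (auto simp: labelling_def two_colored_partition_def points_def dest: arg_cong[of _ _ length])

lemma labelling_block:
  assumes "labelling l u p" "B \<in> blocks p"
  obtains x y where "B = {x, y}" "x \<noteq> y" "x \<in> points p" "y \<in> points p"
    "letter_at l u y = inv_letter (letter_at l u x)"
proof -
  obtain x y where xy: "B = {x, y}" "letter_at l u y = inv_letter (letter_at l u x)"
    using assms by (auto simp: labelling_def)
  moreover have "x \<noteq> y" using xy(2) by auto
  moreover have "B \<subseteq> points p"
    using labellingD(1)[OF assms(1)] assms(2) by (auto simp: partition_on_def)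
  ultimately show thesis using that by auto
qed

lemma normalized_color_letter_at:
  assumes "labelling l u p" "x \<in> points p"
  shows "normalized_color p x = snd (letter_at l u x)"
  using assms(2) labellingD[OF assms(1)] by (cases x) auto

section \<open>Renaming, involution and tensor product of labelled diagrams\<close>

lemma partition_on_image:
  assumes "partition_on A P" "inj f"
  shows "partition_on (f ` A) ((`) f ` P)"
proof -
  have "(`) f ` P - {{}} = (`) f ` P" using assms(1) by (auto simp: partition_on_def)
  then show ?thesis
    using partition_on_inj_image[OF assms(1) inj_on_subset[OF assms(2)]] by simp
qed

lemma partition_on_Un:
  assumes "partition_on A P" "partition_on B Q" "A \<inter> B = {}"
  shows "partition_on (A \<union> B) (P \<union> Q)"
  using assms by (auto simp: partition_on_def intro!: disjoint_union)

text \<open>Serves to shift all levels of the second factor of a tensor product.\<close>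

lemma labelling_rename:
  assumes "labelling l u p"
  shows "labelling (map (map_prod f id) l) (map (map_prod f id) u) p"
proof -
  have *: "letter_at (map (map_prod f id) l) (map (map_prod f id) u) x = map_prod f id (letter_at l u x)"
    if "x \<in> points p" for x
    using that labellingD[OF assms] by (cases x) (auto simp: inv_letter_def)
  have "\<exists>x y. B = {x, y} \<and> letter_at (map (map_prod f id) l) (map (map_prod f id) u) y
      = inv_letter (letter_at (map (map_prod f id) l) (map (map_prod f id) u) x)"
    if B: "B \<in> blocks p" for B
  proof -
    obtain x y where xy: "B = {x, y}" "x \<in> points p" "y \<in> points p"
      "letter_at l u y = inv_letter (letter_at l u x)"
      using labelling_block[OF assms B] by metis
    then show ?thesis
      by (intro exI[of _ x] exI[of _ y]) (simp add: *, simp add: inv_letter_def)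
  qed
  then show ?thesis using assms by (auto simp: labelling_def)
qed

lemma labelling_involution:
  assumes "labelling l u p"
  shows "labelling u l (involution p)"
proof -
  have eq: "points (involution p) = swap_row ` points p"
    by (auto simp: points_def involution_def image_Un image_image)
  have inj: "inj swap_row"
  proof (rule injI)
    show "x = y" if "swap_row x = swap_row y" for x y
      using that by (cases x; cases y) auto
  qed
  have "partition_on (points (involution p)) (blocks (involution p))"
    unfolding eq using partition_on_image[OF labellingD(1)[OF assms] inj] by (simp add: involution_def)
  moreover have "\<exists>x y. B = {x, y} \<and> letter_at u l y = inv_letter (letter_at u l x)"
    if B: "B \<in> blocks (involution p)" for B
  proof -
    \<comment> \<open>Swapping the rows inverts every letter, and being mutually inverse is
      preserved when both letters are inverted.\<close>
    have la: "letter_at u l (swap_row x) = inv_letter (letter_at l u x)" for x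
      by (cases x) auto
    obtain B' where B': "B' \<in> blocks p" "B = swap_row ` B'"
      using B by (auto simp: involution_def)
    obtain x y where xy: "B' = {x, y}" "letter_at l u y = inv_letter (letter_at l u x)"
      using labelling_block[OF assms B'(1)] by metis
    show ?thesis
      by (rule exI[of _ "swap_row x"], rule exI[of _ "swap_row y"]) (simp add: B' xy la)
  qed
  ultimately show ?thesis
    using assms by (simp add: labelling_def two_colored_partition_def involution_def)
qed

lemma labelling_tensor:
  assumes p: "labelling l u p" and q: "labelling l' u' q"
  shows "labelling (l @ l') (u @ u') (tensor p q)"
proof -
  define f where "f = shift (length l) (length u)"
  note pd = labellingD[OF p] and qd = labellingD[OF q]
  have inj: "inj f"
  proof (rule injI)
    show "x = y" if "f x = f y" for x y
      using that by (cases x; cases y) (auto simp: f_def)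
  qed
  have bl: "blocks (tensor p q) = blocks p \<union> (`) f ` blocks q"
    by (simp add: tensor_def f_def pd)
  have sh: "{..<k + n} = {..<k} \<union> (+) k ` {..<n}" for k n :: nat
    by (auto simp: lessThan_atLeast0)
  have fLo: "f ` Lo ` A = Lo ` (+) (length l) ` A" and fUp: "f ` Up ` A = Up ` (+) (length u) ` A" for A
    by (simp_all add: f_def image_image)
  have pt: "points (tensor p q) = points p \<union> f ` points q"
    by (simp add: pd(6) qd(6) image_Un fLo fUp)
      (simp add: points_def tensor_def pd(4,5) qd(4,5) sh image_Un Un_ac)
  have disj: "points p \<inter> f ` points q = {}"
    unfolding pd(6) qd(6) f_def by auto
  have la1: "letter_at (l @ l') (u @ u') x = letter_at l u x" if "x \<in> points p" for x
    using that unfolding pd(6) by (auto simp: nth_append)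
  have la2: "letter_at (l @ l') (u @ u') (f x) = letter_at l' u' x" for x
    by (cases x) (auto simp: f_def nth_append)
  have "partition_on (points (tensor p q)) (blocks (tensor p q))"
    unfolding pt bl
    by (intro partition_on_Un disj pd(1) partition_on_image[OF qd(1)] inj)
  moreover have "\<exists>x y. B = {x, y} \<and>
       letter_at (l @ l') (u @ u') y = inv_letter (letter_at (l @ l') (u @ u') x)"
    if "B \<in> blocks (tensor p q)" for B
    using that unfolding bl
  proof
    assume "B \<in> blocks p"
    then obtain x y where "B = {x, y}" "x \<in> points p" "y \<in> points p"
      "letter_at l u y = inv_letter (letter_at l u x)"
      using labelling_block[OF p] by metis
    then show ?thesis
      by (intro exI[of _ x] exI[of _ y]) (simp add: la1)
  next
    assume "B \<in> (`) f ` blocks q"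
    then obtain B' where B': "B' \<in> blocks q" "B = f ` B'" by auto
    then obtain x y where "B' = {x, y}" "letter_at l' u' y = inv_letter (letter_at l' u' x)"
      using labelling_block[OF q] by metis
    then show ?thesis
      by (intro exI[of _ "f x"] exI[of _ "f y"]) (simp add: B' la2)
  qed
  ultimately show ?thesis
    by (auto simp: labelling_def two_colored_partition_def tensor_def pd qd)
qed

subsection \<open>Composition\<close>

text \<open>A finite partial injection decomposes into paths and cycles, so the component of
  \<open>x\<close>, which has no predecessor, is a path with exactly one source and one
  sink.\<close>

lemma matching_path:
  assumes sv: "single_valued R" and inj: "single_valued (R\<inverse>)" and fin: "finite R"
    and x: "x \<notin> Range R"
  obtains y where "y \<notin> Domain R" "(x, y) \<in> R\<^sup>*"
    "\<And>z. (x, z) \<in> (R \<union> R\<inverse>)\<^sup>* \<Longrightarrow> z \<notin> Range R \<Longrightarrow> z = x"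
    "\<And>z. (x, z) \<in> (R \<union> R\<inverse>)\<^sup>* \<Longrightarrow> z \<notin> Domain R \<Longrightarrow> z = y"
proof -
  \<comment> \<open>A backward step can only undo the forward step before it, by injectivity, so a
    zigzag never leaves the forward orbit of \<open>x\<close>.\<close>
  have comp: "(x, z) \<in> R\<^sup>*" if "(x, z) \<in> (R \<union> R\<inverse>)\<^sup>*" for z
    using that
  proof (induction rule: rtrancl_induct)
    case (step y z)
    show ?case
    proof (cases "(y, z) \<in> R")
      case False
      then have zy: "(z, y) \<in> R" using step by auto
      then have "y \<noteq> x" using x by auto
      then obtain z' where "(x, z') \<in> R\<^sup>*" "(z', y) \<in> R"
        using step.IH by (metis rtranclE)
      then show ?thesis using inj zy by (metis converseI single_valuedD)
    qed (use step.IH in auto)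
  qed auto
  have "\<exists>y. y \<notin> Domain R \<and> (x, y) \<in> R\<^sup>*"
  proof (rule ccontr)
    assume neg: "\<not> ?thesis"
    \<comment> \<open>If every point of the orbit had a successor, the finite set \<open>A\<close>
      would be mapped injectively into \<open>A - {x}\<close>.\<close>
    define A where "A = R\<^sup>* `` {x}"
    have "A \<subseteq> insert x (Range R)" unfolding A_def by (auto elim: rtranclE)
    then have finA: "finite A" using fin finite_subset by (metis finite_Range finite_insert)
    have "\<forall>a\<in>A. \<exists>b. (a, b) \<in> R" using neg unfolding A_def by auto
    then obtain f where f: "\<And>a. a \<in> A \<Longrightarrow> (a, f a) \<in> R" by metis
    have "inj_on f A" using f inj by (metis converseI inj_onI single_valuedD)
    moreover have "f ` A \<subseteq> A - {x}"
      using f x unfolding A_def by (auto intro: rtrancl_into_rtrancl)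
    ultimately have "card A \<le> card (A - {x})" using finA by (metis card_image card_mono finite_Diff)
    moreover have "x \<in> A" by (auto simp: A_def)
    ultimately show False using finA by (metis card_Diff1_less linorder_not_le)
  qed
  then obtain y where y: "y \<notin> Domain R" "(x, y) \<in> R\<^sup>*" by auto
  show thesis
  proof (rule that[OF y])
    fix z assume "(x, z) \<in> (R \<union> R\<inverse>)\<^sup>*" "z \<notin> Range R"
    then show "z = x" using comp by (metis Range.intros rtranclE)
  next
    fix z assume z: "(x, z) \<in> (R \<union> R\<inverse>)\<^sup>*" "z \<notin> Domain R"
    then have "(y, z) \<in> R\<^sup>* \<or> (z, y) \<in> R\<^sup>*"
      using single_valued_confluent[OF sv y(2) comp] by blast
    then show "z = y" using y z by (metis Domain.DomainI converse_rtranclE)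
  qed
qed

lemma labelling_mate_unique:
  assumes "labelling l u p" "{x, y} \<in> blocks p" "{x, z} \<in> blocks p"
  shows "y = z"
proof -
  have "{x, y} = {x, z}"
    using disjointD[OF partition_onD2[OF labellingD(1)[OF assms(1)]] assms(2,3)] by auto
  moreover obtain a b where "{x, y} = {a, b}" "a \<noteq> b" using labelling_block[OF assms(1,2)] by metis
  ultimately show ?thesis by (auto simp: doubleton_eq_iff)
qed

lemma labelling_mate_exists:
  assumes "labelling l u p" "x \<in> points p"
  obtains y where "{x, y} \<in> blocks p" "y \<in> points p" "letter_at l u y = inv_letter (letter_at l u x)"
proof -
  obtain B where B: "B \<in> blocks p" "x \<in> B"
    using labellingD(1)[OF assms(1)] assms(2) by (auto simp: partition_on_def)
  obtain a b where ab: "B = {a, b}" "a \<in> points p" "b \<in> points p" "letter_at l u b = inv_letter (letter_at l u a)"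
    using labelling_block[OF assms(1) B(1)] by metis
  show thesis
  proof (cases "x = a")
    case True
    then show thesis using that[of b] B ab by auto
  next
    case False
    then show thesis using that[of a] B ab by (auto simp: insert_commute)
  qed
qed

lemma labelling_pair:
  assumes "labelling l u p" "{x, y} \<in> blocks p"
  shows "letter_at l u y = inv_letter (letter_at l u x)" "x \<in> points p" "y \<in> points p"
proof -
  obtain a b where ab: "{x, y} = {a, b}" "a \<noteq> b" "a \<in> points p" "b \<in> points p" "letter_at l u b = inv_letter (letter_at l u a)"
    using labelling_block[OF assms] by metis
  then have "x = a \<and> y = b \<or> x = b \<and> y = a" by (auto simp: doubleton_eq_iff)
  then show "letter_at l u y = inv_letter (letter_at l u x)" "x \<in> points p" "y \<in> points p"
    using ab(3-) by auto
qed

text \<open>Neutrality orients every block, from the point of normalized color \<open>c\<close> to the other one.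
  A point of the middle row is the start of one block and the end of another, so the stacked
  diagram decomposes into directed paths between outer points and directed cycles.\<close>

lemma labelling_compose:
  assumes p: "labelling l m p" and q: "labelling m u q"
  shows "labelling l u (compose p q)"
proof -
  note pd = labellingD[OF p] and qd = labellingD[OF q]
  define P where "P = Lo ` {..<length l} \<union> Up ` {..<length u}"
  define E where "E = {(x, y) \<in> P \<times> P. (stack_outer x, stack_outer y) \<in> (stack_link p q)\<^sup>*}"
  define R where "R c =
     {(stack_first x, stack_first y) | x y. {x, y} \<in> blocks p \<and> snd (letter_at l m x) = c} \<union>
     {(stack_second x, stack_second y) | x y. {x, y} \<in> blocks q \<and> snd (letter_at m u x) = c}" for c
  \<comment> \<open>Mates carry opposite colors, so changing the color reverses all arrows.
    Injectivity of \<open>R c\<close> thus comes from single-valuedness of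
    \<open>R (inv_color c)\<close>.\<close>
  have R_converse: "(R c)\<inverse> = R (inv_color c)" for c
  proof -
    have sub: "(b, a) \<in> R (inv_color c)" if "(a, b) \<in> R c" for a b c
      using that unfolding R_def
    proof (elim UnE CollectE exE conjE Pair_inject)
      fix x y assume "a = stack_first x" "b = stack_first y" "{x, y} \<in> blocks p" "snd (letter_at l m x) = c"
      then have "b = stack_first y \<and> a = stack_first x \<and> {y, x} \<in> blocks p \<and> snd (letter_at l m y) = inv_color c"
        using labelling_pair(1)[OF p, of x y] by (simp add: insert_commute)
      then show "(b, a) \<in> {(stack_first x, stack_first y) | x y. {x, y} \<in> blocks p \<and> snd (letter_at l m x) = inv_color c} \<union>
         {(stack_second x, stack_second y) | x y. {x, y} \<in> blocks q \<and> snd (letter_at m u x) = inv_color c}"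
        by blast
    next
      fix x y assume "a = stack_second x" "b = stack_second y" "{x, y} \<in> blocks q" "snd (letter_at m u x) = c"
      then have "b = stack_second y \<and> a = stack_second x \<and> {y, x} \<in> blocks q \<and> snd (letter_at m u y) = inv_color c"
        using labelling_pair(1)[OF q, of x y] by (simp add: insert_commute)
      then show "(b, a) \<in> {(stack_first x, stack_first y) | x y. {x, y} \<in> blocks p \<and> snd (letter_at l m x) = inv_color c} \<union>
         {(stack_second x, stack_second y) | x y. {x, y} \<in> blocks q \<and> snd (letter_at m u x) = inv_color c}"
        by blast
    qed
    show ?thesis using sub[of _ _ c] sub[of _ _ "inv_color c"] by auto
  qed
  have first_eq: "stack_first x = stack_first y \<longleftrightarrow> x = y" for x y
    by (cases x; cases y) auto
  have second_eq: "stack_second x = stack_second y \<longleftrightarrow> x = y" for x y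
    by (cases x; cases y) auto
  have outer_eq: "stack_outer x = stack_outer y \<longleftrightarrow> x = y" for x y
    by (cases x; cases y) auto
  \<comment> \<open>A middle point is an upper point of \<open>p\<close> and a lower point of
    \<open>q\<close>, so its normalized colors there are opposite and only one of its two blocks
    leaves it in \<open>R c\<close>.\<close>
  have mixed: "stack_first x = stack_second y \<Longrightarrow> snd (letter_at l m x) \<noteq> snd (letter_at m u y)" for x y
    by (cases x; cases y) auto
  have sv: "single_valued (R c)" for c
  proof (rule single_valuedI)
    fix a b b' assume ab: "(a, b) \<in> R c" "(a, b') \<in> R c"
    from ab(1) show "b = b'"
      unfolding R_def
    proof (elim UnE CollectE exE conjE Pair_inject)
      fix x y assume xy: "a = stack_first x" "b = stack_first y" "{x, y} \<in> blocks p" "snd (letter_at l m x) = c"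
      from ab(2) obtain y' where "b' = stack_first y'" "{x, y'} \<in> blocks p"
        unfolding R_def using xy by (auto simp: first_eq dest: mixed)
      then show ?thesis using xy labelling_mate_unique[OF p] by blast
    next
      fix x y assume xy: "a = stack_second x" "b = stack_second y" "{x, y} \<in> blocks q" "snd (letter_at m u x) = c"
      from ab(2) obtain y' where "b' = stack_second y'" "{x, y'} \<in> blocks q"
        unfolding R_def using xy by (auto simp: second_eq dest: mixed[OF sym])
      then show ?thesis using xy labelling_mate_unique[OF q] by blast
    qed
  qed
  have fin: "finite (R c)" for c
  proof (rule finite_subset)
    show "R c \<subseteq> (stack_first ` points p \<union> stack_second ` points q) \<times> (stack_first ` points p \<union> stack_second ` points q)"
      unfolding R_def by (auto dest: labelling_pair(2,3)[OF p] labelling_pair(2,3)[OF q])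
    show "finite ((stack_first ` points p \<union> stack_second ` points q) \<times> (stack_first ` points p \<union> stack_second ` points q))"
      by (simp add: points_def)
  qed
  have dom_first: "stack_first x \<in> Domain (R (snd (letter_at l m x)))" if x: "x \<in> points p" for x
  proof -
    obtain y where "{x, y} \<in> blocks p" using labelling_mate_exists[OF p x] by metis
    then have "(stack_first x, stack_first y) \<in> R (snd (letter_at l m x))" unfolding R_def by blast
    then show ?thesis by (rule DomainI)
  qed
  have dom_second: "stack_second x \<in> Domain (R (snd (letter_at m u x)))" if x: "x \<in> points q" for x
  proof -
    obtain y where "{x, y} \<in> blocks q" using labelling_mate_exists[OF q x] by metis
    then have "(stack_second x, stack_second y) \<in> R (snd (letter_at m u x))" unfolding R_def by blast
    then show ?thesis by (rule DomainI)
  qed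
  have dom_outer: "stack_outer x \<in> Domain (R (snd (letter_at l u x)))" if "x \<in> P" for x
    using that dom_first[of x] dom_second[of x] by (cases x) (auto simp: P_def pd(6) qd(6))
  have color_outer: "snd (letter_at l u x) = c" if "stack_outer x \<in> Domain (R c)" for x c
  proof -
    have "letter_at l m y = letter_at l u x" if "stack_outer x = stack_first y" for y
      using that by (cases x; cases y) auto
    moreover have "letter_at m u y = letter_at l u x" if "stack_outer x = stack_second y" for y
      using that by (cases x; cases y) auto
    ultimately show ?thesis using that unfolding R_def by auto
  qed
  \<comment> \<open>A middle point lies in the domains of both \<open>R c\<close> and
    \<open>R (inv_color c)\<close>, so a point without outgoing arrow has to be an outer
    one.\<close>
  have end_outer: "\<exists>y'\<in>P. y = stack_outer y' \<and> snd (letter_at l u y') = inv_color c"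
    if "y \<in> Range (R c)" "y \<notin> Domain (R c)" for y c
  proof -
    have ran: "y \<in> Domain (R (inv_color c))" using that(1) by (simp flip: R_converse)
    have "(\<exists>x\<in>points p. y = stack_first x) \<or> (\<exists>x\<in>points q. y = stack_second x)"
      using that(1) labelling_pair(3)[OF p] labelling_pair(3)[OF q] unfolding R_def by blast
    then obtain y' where y': "y' \<in> P" "y = stack_outer y'"
    proof (elim disjE bexE)
      fix x assume x: "x \<in> points p" "y = stack_first x"
      show thesis
      proof (cases x)
        case (Lo i)
        then show thesis using x that[of x] by (auto simp: P_def pd(6))
      next
        case (Up i)
        then have "stack_second (Lo i) = y" "Lo i \<in> points q" using x by (auto simp: pd(6) qd(6))
        then have "y \<in> Domain (R (snd (m ! i)))" "y \<in> Domain (R (inv_color (snd (m ! i))))"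
          using dom_second[of "Lo i"] dom_first[of x] x Up by auto
        then have "y \<in> Domain (R c)"
          by (cases c; cases "snd (m ! i)") auto
        then show thesis using \<open>y \<notin> Domain (R c)\<close> by simp
      qed
    next
      fix x assume x: "x \<in> points q" "y = stack_second x"
      show thesis
      proof (cases x)
        case (Up i)
        then show thesis using x that[of x] by (auto simp: P_def qd(6))
      next
        case (Lo i)
        then have "stack_first (Up i) = y" "Up i \<in> points p" using x by (auto simp: pd(6) qd(6))
        then have "y \<in> Domain (R (snd (m ! i)))" "y \<in> Domain (R (inv_color (snd (m ! i))))"
          using dom_first[of "Up i"] dom_second[of x] x Lo by auto
        then have "y \<in> Domain (R c)"
          by (cases c; cases "snd (m ! i)") auto
        then show thesis using \<open>y \<notin> Domain (R c)\<close> by simp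
      qed
    qed
    then show ?thesis using color_outer ran by auto
  qed
  \<comment> \<open>Both diagrams give a middle point the same name, so names are constant along a
    path and agree at its two ends.\<close>
  define name where "name z = (case z of Bot i \<Rightarrow> fst (l ! i) | Mid i \<Rightarrow> fst (m ! i) | Top i \<Rightarrow> fst (u ! i))" for z
  have name_outer: "name (stack_outer x) = fst (letter_at l u x)" for x
    by (cases x) (auto simp: name_def)
  have name_first: "name (stack_first x) = fst (letter_at l m x)" for x
    by (cases x) (auto simp: name_def)
  have name_second: "name (stack_second x) = fst (letter_at m u x)" for x
    by (cases x) (auto simp: name_def)
  have name_R: "name a = name b" if "(a, b) \<in> R c" for a b c
    using that unfolding R_def
    by (auto simp: name_first name_second dest: labelling_pair(1)[OF p] labelling_pair(1)[OF q])
  have name_R_star: "name a = name b" if "(a, b) \<in> (R c)\<^sup>*" for a b c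
    using that by induction (auto dest: name_R)
  have link_iff: "(a, b) \<in> stack_link p q \<longleftrightarrow>
      (\<exists>B\<in>blocks p. a \<in> stack_first ` B \<and> b \<in> stack_first ` B) \<or>
      (\<exists>B\<in>blocks q. a \<in> stack_second ` B \<and> b \<in> stack_second ` B)" for a b
    by (simp add: stack_link_def bex_Un)
  have R_link: "R c \<subseteq> stack_link p q" for c
  proof (rule subrelI)
    fix a b assume "(a, b) \<in> R c"
    then show "(a, b) \<in> stack_link p q"
      unfolding R_def link_iff by (elim UnE CollectE exE conjE Pair_inject) blast+
  qed
  have flip: "d = c \<or> d = inv_color c" for c d by (cases c; cases d) auto
  have R_first: "(stack_first x, stack_first y) \<in> R c \<union> (R c)\<inverse>" if "{x, y} \<in> blocks p" for x y c
  proof -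
    have "(stack_first x, stack_first y) \<in> R (snd (letter_at l m x))"
      using that unfolding R_def by blast
    then show ?thesis using flip[of "snd (letter_at l m x)" c] unfolding R_converse by auto
  qed
  have R_second: "(stack_second x, stack_second y) \<in> R c \<union> (R c)\<inverse>" if "{x, y} \<in> blocks q" for x y c
  proof -
    have "(stack_second x, stack_second y) \<in> R (snd (letter_at m u x))"
      using that unfolding R_def by blast
    then show ?thesis using flip[of "snd (letter_at m u x)" c] unfolding R_converse by auto
  qed
  \<comment> \<open>A link joins mates or a point to itself; the reflexive closure takes care of the
    latter.\<close>
  have link_R: "stack_link p q \<subseteq> (R c \<union> (R c)\<inverse>)\<^sup>*" for c
  proof (rule subrelI)
    fix a b assume "(a, b) \<in> stack_link p q"
    then consider x y where "{x, y} \<in> blocks p" "{a, b} \<subseteq> {stack_first x, stack_first y}"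
      | x y where "{x, y} \<in> blocks q" "{a, b} \<subseteq> {stack_second x, stack_second y}"
    proof -
      assume link: "(a, b) \<in> stack_link p q"
      then consider B where "B \<in> blocks p" "{a, b} \<subseteq> stack_first ` B"
        | B where "B \<in> blocks q" "{a, b} \<subseteq> stack_second ` B"
        unfolding link_iff by blast
      then show thesis
      proof cases
        case (1 B)
        obtain x y where "B = {x, y}" using labelling_block[OF p 1(1)] by metis
        then show thesis using that(1)[of x y] 1 by simp
      next
        case (2 B)
        obtain x y where "B = {x, y}" using labelling_block[OF q 2(1)] by metis
        then show thesis using that(2)[of x y] 2 by simp
      qed
    qed
    then show "(a, b) \<in> (R c \<union> (R c)\<inverse>)\<^sup>*"
    proof cases
      case 1
      then show ?thesis using R_first[of x y c] R_first[of y x c] by (auto simp: insert_commute)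
    next
      case 2
      then show ?thesis using R_second[of x y c] R_second[of y x c] by (auto simp: insert_commute)
    qed
  qed
  have link_star: "(stack_link p q)\<^sup>* = (R c \<union> (R c)\<inverse>)\<^sup>*" for c
    using rtrancl_subset_rtrancl[OF link_R[of c]] rtrancl_mono[of "R c \<union> (R c)\<inverse>" "stack_link p q"]
      R_link[of c] R_link[of "inv_color c"] by (auto simp: R_converse)
  have "sym (stack_link p q)" by (auto simp: sym_def stack_link_def)
  then have "sym ((stack_link p q)\<^sup>*)" by (rule sym_rtrancl)
  then have equiv: "equiv P E"
    unfolding E_def by (intro equivI) (auto simp: refl_on_def sym_def trans_def)
  \<comment> \<open>The path leaving \<open>x\<close> in the direction of its own color has one
    source and one sink, and the color of an outer point of the component decides which of the two
    it is.\<close>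
  have class_pair: "\<exists>y\<in>P. E `` {x} = {x, y} \<and> letter_at l u y = inv_letter (letter_at l u x)" if x: "x \<in> P" for x
  proof -
    define c where "c = snd (letter_at l u x)"
    have nran: "stack_outer x \<notin> Range (R c)"
      using color_outer[of x "inv_color c"] by (auto simp: c_def simp flip: R_converse)
    obtain y where y: "y \<notin> Domain (R c)" "(stack_outer x, y) \<in> (R c)\<^sup>*"
      and ux: "\<And>z. (stack_outer x, z) \<in> (R c \<union> (R c)\<inverse>)\<^sup>* \<Longrightarrow> z \<notin> Range (R c) \<Longrightarrow> z = stack_outer x"
      and uy: "\<And>z. (stack_outer x, z) \<in> (R c \<union> (R c)\<inverse>)\<^sup>* \<Longrightarrow> z \<notin> Domain (R c) \<Longrightarrow> z = y"
      using matching_path[OF sv _ fin nran] sv R_converse by metis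
    have "stack_outer x \<noteq> y" using dom_outer[OF x] y(1) by (auto simp: c_def)
    then have "y \<in> Range (R c)" using y(2) by (metis Range.intros rtranclE)
    then obtain y' where y': "y' \<in> P" "y = stack_outer y'" "snd (letter_at l u y') = inv_color c"
      using end_outer y(1) by blast
    have "(x, y') \<in> E"
      using y(2) x y' rtrancl_mono[OF R_link[of c]] by (auto simp: E_def)
    moreover have "z = x \<or> z = y'" if z: "(x, z) \<in> E" for z
    proof -
      have conn: "(stack_outer x, stack_outer z) \<in> (R c \<union> (R c)\<inverse>)\<^sup>*"
        using z by (simp add: E_def link_star[of c])
      show ?thesis
      proof (cases "snd (letter_at l u z) = c")
        case True
        then have "stack_outer z \<notin> Range (R c)"
          using color_outer[of z "inv_color c"] by (auto simp flip: R_converse)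
        then show ?thesis using ux[OF conn] outer_eq by simp
      next
        case False
        then have "stack_outer z \<notin> Domain (R c)" using color_outer[of z c] by auto
        then show ?thesis using uy[OF conn] outer_eq y'(2) by simp
      qed
    qed
    moreover have "(x, x) \<in> E" using x by (simp add: E_def)
    ultimately have "E `` {x} = {x, y'}" by auto
    moreover have "letter_at l u y' = inv_letter (letter_at l u x)"
      using name_R_star[OF y(2)] y'(2,3) by (simp add: name_outer c_def prod_eq_iff)
    ultimately show ?thesis using y'(1) by auto
  qed
  have bl: "blocks (compose p q) = P // E" and pt: "points (compose p q) = P"
    unfolding compose_def P_def E_def by (auto simp: pd(4) qd(5) Let_def points_def)
  show ?thesis
    unfolding labelling_def two_colored_partition_def bl pt
  proof (intro conjI ballI)
    show "partition_on P (P // E)" by (rule partition_on_quotient[OF equiv])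
    show "map snd l = lower (compose p q)" "map snd u = upper (compose p q)"
      by (simp_all add: compose_def pd(2) qd(3))
    fix B assume "B \<in> P // E"
    then obtain x where "x \<in> P" "B = E `` {x}" by (rule quotientE)
    then show "\<exists>x y. B = {x, y} \<and> letter_at l u y = inv_letter (letter_at l u x)"
      using class_pair by blast
  qed
qed

subsection \<open>Levels\<close>

primrec sign :: "color \<Rightarrow> int" where
  "sign White = -1"
| "sign Black = 1"

abbreviation balance :: "color list \<Rightarrow> int" where
  "balance cs \<equiv> sum_list (map sign cs)"

lemma sign_inv_color [simp]: "sign (inv_color c) = - sign c"
  by (cases c) auto

lemma sign_eq_uminus_iff: "sign c + sign d = 0 \<longleftrightarrow> d = inv_color c"
  by (cases c; cases d) auto

lemma balance_inv [simp]: "balance (rev (map inv_color cs)) = - balance cs"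
  by (induction cs) auto

section \<open>Color sums and the boundary word\<close>

lemma color_sum_eq_sum:
  assumes "finite S"
  shows "color_sum p S = (\<Sum>x\<in>S. sign (normalized_color p x))"
proof -
  have card: "int (card {x\<in>S. P x}) = (\<Sum>x\<in>S. of_bool (P x))" for P
    using assms by (simp add: of_bool_def sum.inter_filter flip: sum.inter_filter)
  show ?thesis
    unfolding color_sum_def card sum_subtractf[symmetric]
  proof (rule sum.cong[OF refl])
    show "of_bool (normalized_color p x = Black) - of_bool (normalized_color p x = White)
        = sign (normalized_color p x)" for x
      by (cases "normalized_color p x") auto
  qed
qed

lemma color_sum_set:
  "distinct xs \<Longrightarrow> color_sum p (set xs) = balance (map (normalized_color p) xs)"
  by (simp add: color_sum_eq_sum sum_list_distinct_conv_sum_set o_def)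

lemma set_cyclic_points [simp]: "set (cyclic_points p) = points p"
  by (auto simp: cyclic_points_def points_def atLeast0LessThan)

lemma distinct_cyclic_points [simp]: "distinct (cyclic_points p)"
  by (auto simp: cyclic_points_def distinct_map inj_on_def)

lemma finite_points [simp]: "finite (points p)"
  by (simp add: points_def)

lemma map_normalized_color_cyclic_points:
  "map (normalized_color p) (cyclic_points p) = lower p @ rev (map inv_color (upper p))"
proof -
  have "map (\<lambda>i. inv_color (upper p ! i)) [0..<length (upper p)] = map inv_color (upper p)"
    by (rule nth_equalityI) auto
  then show ?thesis
    by (simp add: cyclic_points_def o_def rev_map[symmetric] map_nth)
qed

lemma map_letter_at_cyclic_points:
  assumes "length l = length (lower p)" "length u = length (upper p)"
  shows "map (letter_at l u) (cyclic_points p) = l @ inv_word u"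
proof -
  have "map (\<lambda>i. inv_letter (u ! i)) [0..<length u] = map inv_letter u"
    by (rule nth_equalityI) auto
  then show ?thesis
    by (simp add: cyclic_points_def inv_word_def o_def rev_map[symmetric] map_nth flip: assms)
qed

text \<open>Summing over the neutral blocks gives zero in total. Upper points count with inverted
  color, so the rows have equal balance.\<close>

lemma P2nb_balance:
  assumes "p \<in> P2nb"
  shows "balance (map (normalized_color p) (cyclic_points p)) = 0" "balance (lower p) = balance (upper p)"
proof -
  have part: "partition_on (points p) (blocks p)" and zero: "\<And>B. B \<in> blocks p \<Longrightarrow> color_sum p B = 0"
    using assms by (auto simp: P2nb_def pair_partition_def two_colored_partition_def neutral_def)
  have "finite B" if "B \<in> blocks p" for B
    using partition_onD1[OF part] that finite_points[of p] by (auto intro: finite_subset)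
  then have "(\<Sum>x\<in>points p. sign (normalized_color p x)) = 0"
    using zero by (simp add: sum.partition[OF finite_points part] color_sum_eq_sum)
  then show *: "balance (map (normalized_color p) (cyclic_points p)) = 0"
    by (simp add: sum_list_distinct_conv_sum_set o_def)
  then show "balance (lower p) = balance (upper p)"
    unfolding map_normalized_color_cyclic_points by simp
qed

lemma P2nb_pair:
  assumes "p \<in> P2nb" "{x, y} \<in> blocks p"
  shows "x \<noteq> y" "normalized_color p y = inv_color (normalized_color p x)" "x \<in> points p" "y \<in> points p"
proof -
  have "card {x, y} = 2" using assms by (auto simp: P2nb_def pair_partition_def)
  then show "x \<noteq> y" by auto
  moreover have "color_sum p {x, y} = 0"
    using assms by (auto simp: P2nb_def neutral_def)
  ultimately show "normalized_color p y = inv_color (normalized_color p x)"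
    by (simp add: color_sum_eq_sum sign_eq_uminus_iff)
  show "x \<in> points p" "y \<in> points p"
    using assms partition_onD1 by (auto simp: P2nb_def pair_partition_def two_colored_partition_def)
qed

lemma P2nb_block_split:
  assumes "p \<in> P2nb" "B \<in> blocks p"
  obtains s x us y t where "B = {x, y}" "cyclic_points p = s @ x # us @ y # t"
proof -
  obtain x y where xy: "B = {x, y}" "x \<noteq> y"
    using assms by (auto simp: P2nb_def pair_partition_def card_2_iff)
  have "x \<in> set (cyclic_points p)" "y \<in> set (cyclic_points p)"
    using P2nb_pair(3,4)[OF assms(1) assms(2)[unfolded xy]] by simp_all
  then obtain s r where sr: "cyclic_points p = s @ x # r" "y \<in> set s \<or> y \<in> set r"
    using xy(2) by (metis Un_iff set_ConsD set_append split_list)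
  from sr(2) show thesis
  proof
    assume "y \<in> set r"
    then obtain us t where "r = us @ y # t" by (metis split_list)
    then show thesis using that[of x y s us t] xy sr by simp
  next
    assume "y \<in> set s"
    then obtain s' us where "s = s' @ y # us" by (metis split_list)
    then show thesis using that[of y x s' us r] xy sr by (simp add: insert_commute)
  qed
qed

lemma labelling_P2nb:
  assumes "labelling l u p"
  shows "p \<in> P2nb"
proof -
  have "card B = 2 \<and> neutral p B" if "B \<in> blocks p" for B
  proof -
    obtain x y where xy: "B = {x, y}" "x \<noteq> y" "x \<in> points p" "y \<in> points p"
      "letter_at l u y = inv_letter (letter_at l u x)"
      using labelling_block[OF assms \<open>B \<in> blocks p\<close>] by metis
    then have "normalized_color p y = inv_color (normalized_color p x)"
      by (simp add: normalized_color_letter_at[OF assms])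
    then show ?thesis using xy by (simp add: neutral_def color_sum_eq_sum)
  qed
  then show ?thesis
    using assms by (auto simp: P2nb_def pair_partition_def labelling_def)
qed

section \<open>Sectors as splittings of the boundary\<close>

lemma int_multiples_iff: "x \<in> int_multiples w \<longleftrightarrow> int w dvd x"
  by (auto simp: int_multiples_def dvd_def)

text \<open>Replaces sectors of the cyclic order by splittings of a list. The legs are left out
  because their signs cancel, and for \<open>w = 0\<close> divisibility means vanishing.\<close>

definition enclosed_dvd :: "nat \<Rightarrow> diagram \<Rightarrow> point list \<Rightarrow> bool" where
  "enclosed_dvd w p zs \<longleftrightarrow> (\<forall>s x us y t. zs = s @ x # us @ y # t \<longrightarrow> {x, y} \<in> blocks p \<longrightarrow>
     int w dvd balance (map (normalized_color p) us))"

text \<open>Rotating by one point affects only the block of that point: its inside and outside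
  change places. Their balances are opposite, since the whole word and the two legs have balance
  zero.\<close>

lemma enclosed_dvd_rotate:
  assumes p: "p \<in> P2nb" and zs: "balance (map (normalized_color p) zs) = 0" "enclosed_dvd w p zs"
  shows "enclosed_dvd w p (rotate n zs)"
proof -
  have "balance (map (normalized_color p) (rotate n zs)) = 0 \<and> enclosed_dvd w p (rotate n zs)"
  proof (induction n)
    case 0
    show ?case using zs by simp
  next
    case (Suc n)
    show ?case
    proof (cases "rotate n zs")
      case Nil
      then show ?thesis using zs by (simp add: enclosed_dvd_def)
    next
      case (Cons z r)
      have *: "int w dvd balance (map (normalized_color p) us)"
        if eq: "r @ [z] = s @ x # us @ y # t" and xy: "{x, y} \<in> blocks p" for s x us y t
      proof (cases t rule: rev_cases)
        \<comment> \<open>The moved point has become the second leg, so \<open>us\<close> lay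
          outside the block before and \<open>s\<close> inside.\<close>
        case Nil
        then have "z = y" "r = s @ x # us" using eq by (simp_all flip: append_assoc append_Cons)
        then have zr: "z # r = [] @ y # s @ x # us" by simp
        then have "int w dvd balance (map (normalized_color p) s)"
          using Suc Cons xy unfolding enclosed_dvd_def by (metis insert_commute)
        moreover have "balance (map (normalized_color p) s) + balance (map (normalized_color p) us) = 0"
          using Suc P2nb_pair(2)[OF p xy] unfolding Cons zr by simp
        ultimately show ?thesis by (metis add_eq_0_iff dvd_minus_iff)
      next
        case (snoc t' z')
        then have "z # r = (z # s) @ x # us @ y # t'" using eq
          by (metis (no_types, lifting) append_Cons append_assoc butlast_snoc)
        then show ?thesis using Suc Cons xy unfolding enclosed_dvd_def by metis
      qed
      have "balance (map (normalized_color p) (r @ [z])) = 0"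
        using Suc Cons by simp
      with * Cons show ?thesis by (simp add: enclosed_dvd_def rotate1_rotate_swap)
    qed
  qed
  then show ?thesis ..
qed

text \<open>A sector may pass the start of the cyclic order, so one direction rotates the list until
  the sector is a prefix. The other reads a splitting of the list as a sector.\<close>

lemma S_cat_iff_enclosed_dvd:
  "p \<in> S_cat w \<longleftrightarrow> p \<in> P2nb \<and> enclosed_dvd w p (cyclic_points p)"
proof (intro iffI conjI; (elim conjE)?)
  assume S: "p \<in> S_cat w"
  then show p: "p \<in> P2nb" by (simp add: S_cat_def)
  show "enclosed_dvd w p (cyclic_points p)"
    unfolding enclosed_dvd_def
  proof (intro allI impI)
    fix s x us y t
    assume eq: "cyclic_points p = s @ x # us @ y # t" and xy: "{x, y} \<in> blocks p"
    have dist: "distinct (s @ x # us @ y # t)" using distinct_cyclic_points[of p] unfolding eq .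
    have pts: "points p = set (s @ x # us @ y # t)" by (simp flip: eq)
    have ends: "balance (map (normalized_color p) (x # us @ [y])) = balance (map (normalized_color p) us)"
      using P2nb_pair(2)[OF p xy] by simp
    show "int w dvd balance (map (normalized_color p) us)"
    proof (cases "s = [] \<and> t = []")
      \<comment> \<open>Here the legs and the points between them exhaust the diagram, which is no
        sector; the total balance serves instead.\<close>
      case True
      then show ?thesis using P2nb_balance(1)[OF p] ends unfolding eq by simp
    next
      case False
      have "sector p (set (x # us @ [y]))"
        unfolding sector_def
      proof (intro conjI exI[of _ "x # us @ [y]"])
        have "\<exists>z. z \<in> points p \<and> z \<notin> set (x # us @ [y])"
        proof (cases s)
          case Nil
          then obtain z t' where "t = z # t'" using False by (cases t) auto
          then show ?thesis using pts dist by (intro exI[of _ z]) auto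
        next
          case (Cons z s')
          then show ?thesis using pts dist by (intro exI[of _ z]) auto
        qed
        then show "set (x # us @ [y]) \<subset> points p" using pts by auto
        show "2 \<le> card (set (x # us @ [y]))" using dist by (subst distinct_card) auto
        have "x # us @ [y] = take (length us + 2) (rotate (length s) (cyclic_points p))"
          unfolding eq rotate_append by simp
        then show "cyclic_interval p (x # us @ [y])" unfolding cyclic_interval_def by blast
      qed (use xy in auto)
      then have "int w dvd color_sum p (set (x # us @ [y]))"
        using S by (auto simp: S_cat_def int_multiples_iff)
      moreover have "color_sum p (set (x # us @ [y])) = balance (map (normalized_color p) us)"
        using dist by (subst color_sum_set) (auto simp: ends[simplified])
      ultimately show ?thesis by simp
    qed
  qed
next
  assume p: "p \<in> P2nb" and dvd: "enclosed_dvd w p (cyclic_points p)"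
  have "int w dvd color_sum p S" if S: "sector p S" for S
  proof -
    obtain a m xs where xs: "xs = take m (rotate a (cyclic_points p))" "S = set xs"
      "{hd xs, last xs} \<in> blocks p"
      using S unfolding sector_def cyclic_interval_def by auto
    have rot: "enclosed_dvd w p (rotate a (cyclic_points p))"
      using enclosed_dvd_rotate[OF p P2nb_balance(1)[OF p] dvd] .
    have "hd xs \<noteq> last xs" using P2nb_pair[OF p xs(3)] by simp
    moreover have "xs \<noteq> []" using S xs(2) by (auto simp: sector_def)
    ultimately obtain x us y where us: "xs = x # us @ [y]"
      by (metis append_Nil append_butlast_last_id hd_Cons_tl last.simps list.sel(1) list.sel(3))
    then have xy: "{x, y} \<in> blocks p" using xs(3) by simp
    have "rotate a (cyclic_points p) = [] @ x # us @ y # drop m (rotate a (cyclic_points p))"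
      using append_take_drop_id[of m "rotate a (cyclic_points p)"] unfolding xs(1)[symmetric] us by simp
    then have "int w dvd balance (map (normalized_color p) us)"
      using rot xy unfolding enclosed_dvd_def by blast
    moreover have "distinct xs" unfolding xs(1) by simp
    then have "color_sum p S = balance (map (normalized_color p) us)"
      using P2nb_pair(2)[OF p xy] unfolding xs(2) by (subst color_sum_set) (auto simp: us)
    ultimately show ?thesis by simp
  qed
  then show "p \<in> S_cat w" using p by (simp add: S_cat_def int_multiples_iff)
qed

text \<open>Reading the boundary as a lattice path, where a black point is a step up and a white point a
  step down, the level of a point is the lower end of its step, taken modulo \<open>w\<close>.\<close>

primrec levels :: "nat \<Rightarrow> int \<Rightarrow> color list \<Rightarrow> int letter list" where
  "levels w h [] = []"
| "levels w h (c # cs) = ((if c = Black then h else h - 1) mod int w, c) # levels w (h + sign c) cs"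

lemma map_snd_levels [simp]: "map snd (levels w h cs) = cs"
  by (induction cs arbitrary: h) auto

lemma length_levels [simp]: "length (levels w h cs) = length cs"
  by (induction cs arbitrary: h) auto

lemma levels_append [simp]: "levels w h (cs @ ds) = levels w h cs @ levels w (h + balance cs) ds"
  by (induction cs arbitrary: h) (auto simp: add.assoc)

text \<open>The lower end of a step does not depend on its direction, so the path run backwards has
  the same levels.\<close>

lemma inv_word_levels:
  "inv_word (levels w h cs) = levels w (h + balance cs) (rev (map inv_color cs))"
proof (induction cs arbitrary: h)
  case (Cons c cs)
  then show ?case by (cases c) (auto simp: algebra_simps)
qed simp

lemma levels_shift:
  "levels w (h + k) cs = map (map_prod (\<lambda>x. (x + k) mod int w) id) (levels w h cs)"
proof (induction cs arbitrary: h)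
  case (Cons c cs)
  show ?case
  proof (cases c)
    case White
    have eq: "h + k - 1 = (h - 1) + k" by simp
    show ?thesis using Cons[of "h - 1"] White by (simp add: eq mod_add_left_eq)
  next
    case Black
    have eq: "h + k + 1 = (h + 1) + k" by simp
    show ?thesis using Cons[of "h + 1"] Black by (simp add: eq mod_add_left_eq)
  qed
qed simp

lemma add_mod_eq_iff: "(h + k) mod int w = h mod int w \<longleftrightarrow> int w dvd k"
  by (metis add_diff_cancel_left' mod_eq_dvd_iff)

text \<open>Two opposite steps separated by a word of balance \<open>b\<close> have lower ends that
  differ by \<open>b\<close>, so the levels of the legs agree iff \<open>w\<close> divides
  \<open>b\<close>.\<close>

lemma S_cat_iff_labelling:
  "p \<in> S_cat w \<longleftrightarrow> labelling (levels w 0 (lower p)) (levels w 0 (upper p)) p"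
proof -
  let ?l = "levels w 0 (lower p)" and ?u = "levels w 0 (upper p)"
  let ?nc = "normalized_color p"
  have letter_pair: "letter_at ?l ?u y = inv_letter (letter_at ?l ?u x) \<longleftrightarrow>
      int w dvd balance (map ?nc us)"
    if p: "p \<in> P2nb" and eq: "cyclic_points p = s @ x # us @ y # t" and xy: "{x, y} \<in> blocks p" for s x us y t
  proof -
    \<comment> \<open>The reversed upper row starts at its own balance, which is the height where
      the lower row ends, so the two rows join into one path.\<close>
    have W: "map (letter_at ?l ?u) (cyclic_points p) = levels w 0 (map ?nc (cyclic_points p))"
      by (simp add: map_letter_at_cyclic_points map_normalized_color_cyclic_points inv_word_levels
          P2nb_balance(2)[OF p] del: levels.simps)
    define h where "h = balance (map ?nc s)"
    have "map (letter_at ?l ?u) s @ letter_at ?l ?u x # map (letter_at ?l ?u) us @ letter_at ?l ?u y # map (letter_at ?l ?u) t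
        = levels w 0 (map ?nc s) @ ((if ?nc x = Black then h else h - 1) mod int w, ?nc x) # levels w (h + sign (?nc x)) (map ?nc us) @
          ((if ?nc y = Black then h + sign (?nc x) + balance (map ?nc us) else h + sign (?nc x) + balance (map ?nc us) - 1) mod int w, ?nc y) #
          levels w (h + sign (?nc x) + balance (map ?nc us) + sign (?nc y)) (map ?nc t)"
      using W unfolding eq by (simp add: h_def algebra_simps)
    then have "letter_at ?l ?u x = ((if ?nc x = Black then h else h - 1) mod int w, ?nc x)"
      "letter_at ?l ?u y = ((if ?nc y = Black then h + sign (?nc x) + balance (map ?nc us) else h + sign (?nc x) + balance (map ?nc us) - 1) mod int w, ?nc y)"
      by (simp_all add: append_eq_append_conv)
    then show ?thesis
      using P2nb_pair(2)[OF p xy] add_mod_eq_iff[of h "balance (map ?nc us)" w]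
        add_mod_eq_iff[of "h - 1" "balance (map ?nc us)" w]
      by (cases "?nc x") (auto simp: inv_letter_def algebra_simps)
  qed
  show ?thesis
    unfolding S_cat_iff_enclosed_dvd
  proof (intro iffI conjI; (elim conjE)?)
    assume p: "p \<in> P2nb" and dvd: "enclosed_dvd w p (cyclic_points p)"
    have "\<exists>x y. B = {x, y} \<and> letter_at ?l ?u y = inv_letter (letter_at ?l ?u x)" if B: "B \<in> blocks p" for B
    proof -
      obtain s x us y t where xy: "B = {x, y}" and eq: "cyclic_points p = s @ x # us @ y # t"
        using P2nb_block_split[OF p B] by metis
      then have "int w dvd balance (map ?nc us)"
        using dvd B unfolding enclosed_dvd_def by blast
      then show ?thesis using letter_pair[OF p eq] B xy by blast
    qed
    then show "labelling ?l ?u p"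
      using p by (simp add: labelling_def P2nb_def pair_partition_def)
  next
    assume lab: "labelling ?l ?u p"
    then show p: "p \<in> P2nb" by (rule labelling_P2nb)
    show "enclosed_dvd w p (cyclic_points p)"
      unfolding enclosed_dvd_def using letter_pair[OF p] labelling_pair(1)[OF lab] by blast
  qed
qed

section \<open>The sets \<open>S_cat w\<close> are categories\<close>

lemma labelling_Id_part: "map snd l = cs \<Longrightarrow> labelling l l (Id_part cs)"
proof -
  assume cs: "map snd l = cs"
  have "partition_on (points (Id_part cs)) (blocks (Id_part cs))"
    by (rule partition_onI) (auto simp: points_def Id_part_def disjnt_def)
  then show ?thesis
    using cs by (fastforce simp: labelling_def two_colored_partition_def Id_part_def)
qed

lemma labelling_cup: "labelling [x, inv_letter x] [] (Diagram [snd x, inv_color (snd x)] [] {{Lo 0, Lo 1}})"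
proof -
  let ?p = "Diagram [snd x, inv_color (snd x)] [] {{Lo 0, Lo 1}}"
  have "{Lo 0, Lo 1} = points ?p" by (auto simp: points_def lessThan_Suc)
  moreover have "partition_on (points ?p) {points ?p}"
    by (rule partition_on_space) (simp add: points_def lessThan_Suc)
  moreover have "\<exists>y z. {Lo 0, Lo 1} = {y, z} \<and>
      letter_at [x, inv_letter x] [] z = inv_letter (letter_at [x, inv_letter x] [] y)"
    by (intro exI[of _ "Lo 0"] exI[of _ "Lo 1"]) simp
  ultimately show ?thesis
    by (simp add: labelling_def two_colored_partition_def)
qed

text \<open>Levels depend only on the colors of the rows, so each closure lemma for labellings
  yields the level labelling of the result. In a composition the common row has the same levels in
  both factors.\<close>

lemma category_S_cat: "category (S_cat w)"
  unfolding category_def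
proof (intro conjI ballI impI)
  show "two_colored_partition p" if "p \<in> S_cat w" for p
    using that by (simp add: S_cat_iff_labelling labelling_def)
  have "Id_part cs \<in> S_cat w" for cs
    using labelling_Id_part[of "levels w 0 cs" cs] by (simp add: S_cat_iff_labelling Id_part_def)
  then show "Id_part [White] \<in> S_cat w" "Id_part [Black] \<in> S_cat w" by this+
  \<comment> \<open>Starting from height 0, a cup has level 0 if it goes up first and level -1 if it
    goes down first.\<close>
  show "Diagram [Black, White] [] {{Lo 0, Lo 1}} \<in> S_cat w" "Diagram [White, Black] [] {{Lo 0, Lo 1}} \<in> S_cat w"
    unfolding S_cat_iff_labelling
    using labelling_cup[of "(0, Black)"] labelling_cup[of "(-1 mod int w, White)"] by simp_all
  fix p assume p: "p \<in> S_cat w"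
  note lp = p[unfolded S_cat_iff_labelling]
  show "involution p \<in> S_cat w"
    using labelling_involution[OF lp] by (simp add: S_cat_iff_labelling involution_def)
  fix q assume q: "q \<in> S_cat w"
  note lq = q[unfolded S_cat_iff_labelling]
  show "tensor p q \<in> S_cat w"
  proof -
    \<comment> \<open>In the product both rows of \<open>q\<close> start at the same height, the
      balance of \<open>p\<close>, hence the common shift of their levels.\<close>
    have tot: "balance (upper p) = balance (lower p)" using P2nb_balance(2) p by (auto simp: S_cat_def)
    show ?thesis
      using labelling_tensor[OF lp labelling_rename[OF lq, of "\<lambda>x. (x + balance (lower p)) mod int w"]]
      by (simp add: S_cat_iff_labelling tensor_def tot flip: levels_shift)
  qed
  show "compose p q \<in> S_cat w" if "composable p q"
    using labelling_compose[OF lp, of "levels w 0 (upper q)" q] lq that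
    by (simp add: S_cat_iff_labelling compose_def composable_def)
qed

subsection \<open>The group of a category\<close>

locale partition_category =
  fixes C :: "diagram set"
  assumes category: "category C"
begin

definition word_eq :: "'n letter list \<Rightarrow> 'n letter list \<Rightarrow> bool" (infix "\<approx>" 50) where
  "l \<approx> u \<longleftrightarrow> (\<exists>p\<in>C. labelling l u p)"

lemma word_eq_sym: "l \<approx> u \<Longrightarrow> u \<approx> l"
  using category labelling_involution unfolding word_eq_def category_def by blast

lemma word_eq_trans [trans]: "l \<approx> m \<Longrightarrow> m \<approx> u \<Longrightarrow> l \<approx> u"
  unfolding word_eq_def
proof (elim bexE)
  fix p q assume pq: "p \<in> C" "q \<in> C" "labelling l m p" "labelling m u q"
  then have "composable p q" by (simp add: composable_def labellingD)
  then have "compose p q \<in> C" using category pq by (simp add: category_def)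
  then show "\<exists>p\<in>C. labelling l u p" using labelling_compose pq by blast
qed

lemma word_eq_append: "l \<approx> u \<Longrightarrow> l' \<approx> u' \<Longrightarrow> l @ l' \<approx> u @ u'"
  using category labelling_tensor unfolding word_eq_def category_def by blast

lemma word_eq_cup: "[x, inv_letter x] \<approx> []"
proof -
  have "Diagram [snd x, inv_color (snd x)] [] {{Lo 0, Lo 1}} \<in> C"
    using category by (cases "snd x") (simp_all add: category_def)
  then show ?thesis using labelling_cup unfolding word_eq_def by blast
qed

lemma word_eq_refl [simp]: "l \<approx> l"
proof (induction l)
  case Nil
  show ?case using word_eq_trans[OF word_eq_sym[OF word_eq_cup] word_eq_cup] .
next
  case (Cons x l)
  have "Id_part [snd x] \<in> C"
    using category by (cases "snd x") (simp_all add: category_def)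
  then have "[x] \<approx> [x]" using labelling_Id_part[of "[x]"] by (auto simp: word_eq_def)
  then show ?case using word_eq_append[OF _ Cons] by force
qed

lemma word_eq_cong: "l \<approx> u \<Longrightarrow> s @ l @ t \<approx> s @ u @ t"
  by (intro word_eq_append word_eq_refl)

lemma word_eq_cancel: "l \<approx> [] \<Longrightarrow> s @ l @ t \<approx> s @ t"
  using word_eq_cong[of l "[]" s t] by simp

lemma word_eq_inv_right: "u @ inv_word u \<approx> []"
proof (induction u)
  case (Cons x u)
  show ?case
    using word_eq_trans[OF word_eq_cancel[OF Cons, of "[x]" "[inv_letter x]"]] word_eq_cup[of x] by simp
qed simp

lemma word_eq_inv_left: "inv_word u @ u \<approx> []"
  using word_eq_inv_right[of "inv_word u"] by simp

text \<open>Moving \<open>u\<close> to the other side reduces every relation to the triviality of a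
  boundary word.\<close>

lemma word_eq_iff_Nil: "l \<approx> u \<longleftrightarrow> l @ inv_word u \<approx> []"
proof
  assume "l \<approx> u"
  then show "l @ inv_word u \<approx> []"
    using word_eq_trans[OF word_eq_append[OF _ word_eq_refl] word_eq_inv_right] by blast
next
  assume *: "l @ inv_word u \<approx> []"
  have "l \<approx> l @ inv_word u @ u"
    using word_eq_sym[OF word_eq_cancel[OF word_eq_inv_left, of l u "[]"]] by simp
  also have "\<dots> \<approx> u" using word_eq_cancel[OF *, of "[]" u] by simp
  finally show "l \<approx> u" .
qed

text \<open>\<open>v u\<close> is the conjugate of \<open>u v\<close> by \<open>v\<close>. Thus a
  boundary may be read from any starting point.\<close>

lemma word_eq_Nil_rotate: "u @ v \<approx> [] \<Longrightarrow> v @ u \<approx> []"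
proof -
  assume *: "u @ v \<approx> []"
  have "v @ u \<approx> v @ u @ v @ inv_word v"
    using word_eq_sym[OF word_eq_cancel[OF word_eq_inv_right, of "v @ u" v "[]"]] by simp
  also have "\<dots> \<approx> v @ inv_word v" using word_eq_cancel[OF *, of v "inv_word v"] by simp
  also have "\<dots> \<approx> []" by (rule word_eq_inv_right)
  finally show ?thesis .
qed

lemma word_eq_inv: "l \<approx> u \<Longrightarrow> inv_word l \<approx> inv_word u"
  using word_eq_sym[of "inv_word u" "inv_word l"] word_eq_Nil_rotate[of l "inv_word u"]
  by (simp add: word_eq_iff_Nil[of "inv_word u"] word_eq_iff_Nil[of l])

section \<open>Commuting words and interchangeable labels\<close>

definition commute :: "'n letter list \<Rightarrow> 'n letter list \<Rightarrow> bool" where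
  "commute u v \<longleftrightarrow> u @ v \<approx> v @ u"

lemma commute_sym: "commute u v \<Longrightarrow> commute v u"
  by (simp add: commute_def word_eq_sym)

lemma commute_append:
  assumes "commute x u" "commute x v"
  shows "commute x (u @ v)"
proof -
  have "x @ u @ v \<approx> u @ x @ v" using word_eq_cong[of "x @ u" "u @ x" "[]" v] assms(1) by (simp add: commute_def)
  also have "\<dots> \<approx> u @ v @ x" using word_eq_cong[of "x @ v" "v @ x" u "[]"] assms(2) by (simp add: commute_def)
  finally show ?thesis by (simp add: commute_def)
qed

lemma commute_cong:
  assumes "commute x u" "u \<approx> v"
  shows "commute x v"
proof -
  have "x @ v \<approx> x @ u" using assms(2) by (simp add: word_eq_append word_eq_sym)
  also have "\<dots> \<approx> u @ x" using assms(1) by (simp add: commute_def)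
  also have "\<dots> \<approx> v @ x" using assms(2) by (simp add: word_eq_append)
  finally show ?thesis by (simp add: commute_def)
qed

lemma commute_inv:
  assumes "commute x u"
  shows "commute x (inv_word u)"
proof -
  have "x @ inv_word u \<approx> inv_word u @ u @ x @ inv_word u"
    using word_eq_sym[OF word_eq_cancel[OF word_eq_inv_left, of "[]" u "x @ inv_word u"]] by simp
  also have "\<dots> \<approx> inv_word u @ x @ u @ inv_word u"
    using word_eq_cong[of "u @ x" "x @ u" "inv_word u" "inv_word u"] assms
    by (simp add: commute_def word_eq_sym)
  also have "\<dots> \<approx> inv_word u @ x"
    using word_eq_cancel[OF word_eq_inv_right, of "inv_word u @ x" u "[]"] by simp
  finally show ?thesis by (simp add: commute_def)
qed

lemma commute_conj:
  assumes "commute u v"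
  shows "commute (s @ u @ inv_word s) (s @ v @ inv_word s)"
proof -
  have cancel: "s @ u @ inv_word s @ s @ v @ inv_word s \<approx> s @ u @ v @ inv_word s" for u v
    using word_eq_cancel[OF word_eq_inv_left, of "s @ u" s "v @ inv_word s"] by simp
  have "s @ u @ inv_word s @ s @ v @ inv_word s \<approx> s @ u @ v @ inv_word s" by (rule cancel)
  also have "\<dots> \<approx> s @ v @ u @ inv_word s"
    using word_eq_cong[of "u @ v" "v @ u" s "inv_word s"] assms by (simp add: commute_def)
  also have "\<dots> \<approx> s @ v @ inv_word s @ s @ u @ inv_word s" by (rule word_eq_sym[OF cancel])
  finally show ?thesis by (simp add: commute_def)
qed

text \<open>\<open>relabels v\<close> is the condition under which the label of a block enclosing \<open>v\<close> is immaterial; see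
  \<open>relabelsD\<close>.\<close>

definition relabels :: "'n letter list \<Rightarrow> bool" where
  "relabels v \<longleftrightarrow> (\<forall>a b. commute [(b, White), (a, Black)] v)"

text \<open>A centralizer is a subgroup, and membership depends only on the group element.\<close>

lemma relabels_append: "relabels u \<Longrightarrow> relabels v \<Longrightarrow> relabels (u @ v)"
  and relabels_inv: "relabels u \<Longrightarrow> relabels (inv_word u)"
  and relabels_cong: "relabels u \<Longrightarrow> u \<approx> v \<Longrightarrow> relabels v"
  by (auto simp: relabels_def intro: commute_append commute_inv commute_cong)

lemma relabels_Nil: "relabels []"
  by (simp add: relabels_def commute_def)

text \<open>Insert \<open>b b^-1\<close> in front, move \<open>b^-1 a\<close> past \<open>v\<close>
  and cancel \<open>a a^-1\<close>.\<close>

lemma relabelsD: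
  assumes "relabels v"
  shows "(a, Black) # v @ [(a, White)] \<approx> (b, Black) # v @ [(b, White)]"
proof -
  have "(a, Black) # v @ [(a, White)] \<approx> [(b, Black), (b, White), (a, Black)] @ v @ [(a, White)]"
    using word_eq_sym[OF word_eq_cancel[OF word_eq_cup[of "(b, Black)"], of "[]" "(a, Black) # v @ [(a, White)]"]]
    by simp
  also have "\<dots> \<approx> (b, Black) # v @ [(b, White), (a, Black), (a, White)]"
    using word_eq_cong[of "[(b, White), (a, Black)] @ v" "v @ [(b, White), (a, Black)]" "[(b, Black)]" "[(a, White)]"]
      assms by (simp add: relabels_def commute_def)
  also have "\<dots> \<approx> (b, Black) # v @ [(b, White)]"
    using word_eq_cancel[OF word_eq_cup[of "(a, Black)"], of "(b, Black) # v @ [(b, White)]" "[]"] by simp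
  finally show ?thesis .
qed

text \<open>Multiply the relation by \<open>b^-1\<close> on the left and by \<open>a\<close> on the
  right.\<close>

lemma relabelsI:
  assumes "\<And>a b. (a, Black) # v @ [(a, White)] \<approx> (b, Black) # v @ [(b, White)]"
  shows "relabels v"
  unfolding relabels_def commute_def
proof (intro allI)
  fix a b
  have "[(b, White), (a, Black)] @ v \<approx> [(b, White), (a, Black)] @ v @ [(a, White), (a, Black)]"
    using word_eq_sym[OF word_eq_cancel[OF word_eq_cup[of "(a, White)"], of "[(b, White), (a, Black)] @ v" "[]"]] by simp
  also have "\<dots> \<approx> [(b, White), (b, Black)] @ v @ [(b, White), (a, Black)]"
    using word_eq_cong[OF assms[of a b], of "[(b, White)]" "[(a, Black)]"] by simp
  also have "\<dots> \<approx> v @ [(b, White), (a, Black)]"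
    using word_eq_cancel[OF word_eq_cup[of "(b, White)"], of "[]" "v @ [(b, White), (a, Black)]"] by simp
  finally show "[(b, White), (a, Black)] @ v \<approx> v @ [(b, White), (a, Black)]" .
qed

subsection \<open>Powers of a letter\<close>

definition lpow :: "'n \<Rightarrow> int \<Rightarrow> 'n letter list" where
  "lpow e k = (if k \<ge> 0 then replicate (nat k) (e, Black) else replicate (nat (- k)) (e, White))"

lemma lpow_0 [simp]: "lpow e 0 = []"
  by (simp add: lpow_def)

lemma inv_word_lpow [simp]: "inv_word (lpow e k) = lpow e (- k)"
  by (auto simp: lpow_def inv_word_def map_replicate)

lemma lpow_Black: "lpow e k @ [(e, Black)] \<approx> lpow e (k + 1)"
proof (cases "k \<ge> 0")
  case True
  then show ?thesis by (simp add: lpow_def nat_add_distrib replicate_append_same)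
next
  case False
  then have "nat (- k) = Suc (nat (- (k + 1)))" by simp
  then have "lpow e k = replicate (nat (- (k + 1))) (e, White) @ [(e, White)]"
    using False by (simp add: lpow_def replicate_append_same)
  moreover have "lpow e (k + 1) = replicate (nat (- (k + 1))) (e, White)"
    using False by (auto simp: lpow_def)
  ultimately show ?thesis
    using word_eq_cancel[OF word_eq_cup[of "(e, White)"], of "replicate (nat (- (k + 1))) (e, White)" "[]"] by simp
qed

lemma lpow_White: "lpow e k @ [(e, White)] \<approx> lpow e (k - 1)"
proof -
  have "lpow e k @ [(e, White)] \<approx> (lpow e (k - 1) @ [(e, Black)]) @ [(e, White)]"
    using word_eq_append[OF word_eq_sym[OF lpow_Black[of e "k - 1"]] word_eq_refl] by simp
  also have "\<dots> \<approx> lpow e (k - 1)"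
    using word_eq_cancel[OF word_eq_cup[of "(e, Black)"], of "lpow e (k - 1)" "[]"] by simp
  finally show ?thesis .
qed

text \<open>Words over a single name live in the cyclic group generated by that letter, so only the
  exponent sum survives.\<close>

lemma map_Pair_word_eq_lpow: "map (Pair e) cs \<approx> lpow e (balance cs)"
proof (induction cs rule: rev_induct)
  case (snoc c cs)
  have "map (Pair e) cs @ [(e, c)] \<approx> lpow e (balance cs) @ [(e, c)]"
    by (rule word_eq_append[OF snoc word_eq_refl])
  also have "\<dots> \<approx> lpow e (balance cs + sign c)"
    using lpow_Black[of e "balance cs"] lpow_White[of e "balance cs"] by (cases c) auto
  finally show ?case by simp
qed simp

lemma lpow_add: "lpow e j @ lpow e k \<approx> lpow e (j + k)"
proof -
  have "map snd (lpow e i) = (if i \<ge> 0 then replicate (nat i) Black else replicate (nat (- i)) White)" for i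
    by (simp add: lpow_def)
  then have "lpow e i = map (Pair e) (map snd (lpow e i))" "balance (map snd (lpow e i)) = i" for i
    by (auto simp: lpow_def sum_list_replicate)
  then show ?thesis using map_Pair_word_eq_lpow[of e "map snd (lpow e j) @ map snd (lpow e k)"]
    by (metis map_append sum_list_append)
qed

lemma lpow_conj_add:
  "lpow e k @ (lpow e l @ v @ lpow e m) @ lpow e n \<approx> lpow e (k + l) @ v @ lpow e (m + n)"
  using word_eq_append[OF lpow_add[of e k l] word_eq_append[OF word_eq_refl[of v] lpow_add[of e m n]]] by simp

lemma relabels_lpow_multiple:
  assumes "relabels (lpow e w)"
  shows "relabels (lpow e (w * k))"
proof (induction k rule: int_induct[of _ 0])
  case base
  show ?case by (simp add: relabels_Nil)
next
  case (step1 i)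
  show ?case
    using relabels_cong[OF relabels_append[OF step1(2) assms] lpow_add] by (simp add: algebra_simps)
next
  case (step2 i)
  show ?case
    using relabels_cong[OF relabels_append[OF step2(2) relabels_inv[OF assms, simplified]] lpow_add]
    by (simp add: algebra_simps)
qed

text \<open>Go to height \<open>k\<close> along \<open>e\<close>, read \<open>a\<close> there and
  return to height 0; the extra -1 in the last exponent undoes the step up taken by
  \<open>a\<close>.\<close>

definition step :: "'n \<Rightarrow> 'n \<Rightarrow> int \<Rightarrow> 'n letter list" where
  "step e a k = lpow e k @ [(a, Black)] @ lpow e (- k - 1)"

text \<open>Up to a power of \<open>e\<close>, a word is the product of the steps \<open>e\<^bsup>k\<^esup> a e\<^bsup>- k - 1\<^esup>\<close> of its lattice path.\<close>

lemma relabels_of_steps: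
  fixes v :: "'n letter list" and e :: 'n
  assumes steps: "\<And>a k. relabels (step e a k)" and w: "relabels (lpow e (int w))"
    and v: "int w dvd balance (map snd v)"
  shows "relabels v"
proof -
  \<comment> \<open>Inserting \<open>e^-h e^h\<close> after each prefix of balance \<open>h\<close>
    splits off one step per letter.\<close>
  have normal: "relabels (v @ lpow e (- balance (map snd v)))" for v
  proof (induction v rule: rev_induct)
    case Nil
    show ?case by (simp add: relabels_Nil)
  next
    case (snoc x v)
    define h where "h = balance (map snd v)"
    have "relabels (lpow e h @ [x] @ lpow e (- h - sign (snd x)))"
    proof (cases x)
      case (Pair a c)
      show ?thesis
      proof (cases c)
        case Black
        then show ?thesis using steps[of a h] Pair by (simp add: step_def)
      next
        case White
        \<comment> \<open>A white letter goes down from height \<open>h\<close>, so it contributes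
          the inverse of a step at level \<open>h - 1\<close>.\<close>
        have "inv_word (step e a (h - 1)) = lpow e h @ [x] @ lpow e (- h - sign (snd x))"
          using Pair White by (simp add: step_def)
        then show ?thesis using relabels_inv[OF steps[of a "h - 1"]] by simp
      qed
    qed
    then have "relabels ((v @ lpow e (- h)) @ (lpow e h @ [x] @ lpow e (- h - sign (snd x))))"
      by (rule relabels_append[OF snoc[folded h_def]])
    moreover have "(v @ lpow e (- h)) @ (lpow e h @ [x] @ lpow e (- h - sign (snd x))) \<approx>
        (v @ [x]) @ lpow e (- balance (map snd (v @ [x])))"
      using word_eq_cancel[OF word_eq_inv_left[of "lpow e h"], of v "[x] @ lpow e (- h - sign (snd x))"]
      by (simp add: h_def)
    ultimately show ?case by (rule relabels_cong)
  qed
  define h where "h = balance (map snd v)"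
  have "relabels (lpow e h)" using relabels_lpow_multiple[OF w] v unfolding h_def by (metis dvdE)
  then have "relabels ((v @ lpow e (- h)) @ lpow e h)"
    by (rule relabels_append[OF normal[of v, folded h_def]])
  moreover have "(v @ lpow e (- h)) @ lpow e h \<approx> v"
    using word_eq_cancel[OF word_eq_inv_left[of "lpow e h"], of v "[]"] by simp
  ultimately show ?thesis by (rule relabels_cong)
qed

text \<open>Inverses of the white words are the black words of length \<open>w\<close>. Padding
  \<open>a\<close> with copies of \<open>e\<close> to such a word gives any step up to powers of
  \<open>e^w\<close>, which have the property as well.\<close>

lemma relabels_of_whites:
  fixes v :: "'n letter list"
  assumes w: "w \<ge> 1" and whites: "\<And>ns :: 'n list. length ns = w \<Longrightarrow> relabels (map (\<lambda>n. (n, White)) ns)"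
    and v: "int w dvd balance (map snd v)"
  shows "relabels v"
proof -
  obtain e :: 'n where True by simp
  have blacks: "relabels (map (\<lambda>n. (n, Black)) ns)" if "length ns = w" for ns :: "'n list"
    using relabels_inv[OF whites[of "rev ns"]] that by (simp add: inv_word_def rev_map o_def)
  have pw: "relabels (lpow e (int w))"
    using blacks[of "replicate w e"] by (simp add: lpow_def map_replicate)
  show ?thesis
  proof (rule relabels_of_steps[OF _ pw v])
    fix a k
    \<comment> \<open>The remainder \<open>r\<close> is the position of \<open>a\<close> in the
      padded word, and the quotient \<open>q\<close> is made up for by powers of \<open>e^w\<close>
      on both sides.\<close>
    define q r where "q = k div int w" and "r = nat (k mod int w)"
    have k: "k = int w * q + int r" and "r < w"
      using w by (simp_all add: q_def r_def nat_less_iff)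
    then obtain m where m: "w = r + m + 1" using less_iff_Suc_add by auto
    have lpow_nat: "lpow e (int n) = map (\<lambda>n. (n, Black)) (replicate n e)" for n
      by (simp add: lpow_def map_replicate)
    have block: "relabels (lpow e (int r) @ [(a, Black)] @ lpow e (int m))"
      using blacks[of "replicate r e @ a # replicate m e"] m by (simp add: lpow_nat)
    have "relabels (lpow e (int w * q) @ (lpow e (int r) @ [(a, Black)] @ lpow e (int m)) @ lpow e (int w * (- q - 1)))"
      by (intro relabels_append block relabels_lpow_multiple pw)
    moreover have "lpow e (int w * q) @ (lpow e (int r) @ [(a, Black)] @ lpow e (int m)) @ lpow e (int w * (- q - 1)) \<approx> step e a k"
    proof -
      have "int m + int w * (- q - 1) = - k - 1" using k m by (simp add: algebra_simps)
      then show ?thesis using lpow_conj_add[of e "int w * q" "int r" "[(a, Black)]" "int m" "int w * (- q - 1)"]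
        unfolding step_def using k by simp
    qed
    ultimately show "relabels (step e a k)" by (rule relabels_cong)
  qed
qed

text \<open>By conjugation with \<open>e\<close>, whether all steps of levels \<open>j\<close> and \<open>k\<close> commute depends only on \<open>k - j\<close>. The mountains
  give this for \<open>k > j\<close>, hence by symmetry for \<open>k < j\<close>, and \<open>H\<close> gives it for \<open>k = j\<close>.\<close>

lemma relabels_of_mountains:
  fixes v :: "'n letter list"
  assumes mountains: "\<And>ms ns :: 'n list. length ms = length ns \<Longrightarrow> ms \<noteq> [] \<Longrightarrow>
      relabels (map (\<lambda>n. (n, Black)) ms @ map (\<lambda>n. (n, White)) ns)"
    and H: "\<And>a b c :: 'n. [(a, White), (c, Black), (b, White)] \<approx> [(b, White), (c, Black), (a, White)]"
    and v: "balance (map snd v) = 0"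
  shows "relabels v"
proof -
  obtain e :: 'n where True by simp
  \<comment> \<open>At a level \<open>k >= 0\<close> the step is a mountain: \<open>k + 1\<close>
    black letters, the last one being \<open>a\<close>, followed by \<open>k + 1\<close> white
    ones.\<close>
  have nonneg: "relabels (step e a k)" if k: "k \<ge> 0" for a k
  proof -
    have "lpow e (- k - 1) = map (\<lambda>n. (n, White)) (replicate (Suc (nat k)) e)"
      "lpow e k = map (\<lambda>n. (n, Black)) (replicate (nat k) e)"
      using k by (simp_all add: lpow_def map_replicate nat_add_distrib)
    then show ?thesis
      using mountains[of "replicate (nat k) e @ [a]" "replicate (Suc (nat k)) e"] by (simp add: step_def)
  qed
  have minus_one: "step e a (-1) = [(e, White), (a, Black)]" for a
    by (simp add: step_def lpow_def)
  \<comment> \<open>Each \<open>b^-1 a\<close> is the product of the inverse of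
    \<open>e^-1 b\<close> with \<open>e^-1 a\<close>, so commuting with the steps of level -1
    suffices.\<close>
  have relabels_iff: "relabels u \<longleftrightarrow> (\<forall>a. commute (step e a (-1)) u)" for u
  proof
    assume *: "\<forall>a. commute (step e a (-1)) u"
    have "commute [(b, White), (a, Black)] u" for a b
    proof -
      have "commute u (inv_word (step e b (-1)) @ step e a (-1))"
        using * by (intro commute_append commute_inv) (simp_all add: commute_sym)
      moreover have "inv_word (step e b (-1)) @ step e a (-1) \<approx> [(b, White), (a, Black)]"
        using word_eq_cancel[OF word_eq_cup[of "(e, Black)"], of "[(b, White)]" "[(a, Black)]"]
        by (simp add: minus_one)
      ultimately show ?thesis by (metis commute_cong commute_sym)
    qed
    then show "relabels u" by (simp add: relabels_def)
  qed (simp add: relabels_def minus_one)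
  \<comment> \<open>\<open>H\<close> exchanges the outer letters of \<open>b^-1 a e^-1\<close>, and
    its inverse then exchanges those of \<open>a b^-1 c\<close>.\<close>
  have H': "commute [(b, White), (a, Black)] [(e, White), (c, Black)]" for a b c
  proof -
    have "[(b, White), (a, Black), (e, White), (c, Black)] \<approx> [(e, White), (a, Black), (b, White), (c, Black)]"
      using word_eq_append[OF H[of b a e] word_eq_refl[of "[(c, Black)]"]] by simp
    also have "\<dots> \<approx> [(e, White), (c, Black), (b, White), (a, Black)]"
      using word_eq_append[OF word_eq_refl[of "[(e, White)]"] word_eq_inv[OF H[of c b a]]] by simp
    finally show ?thesis by (simp add: commute_def)
  qed
  \<comment> \<open>A step of level -1 commutes with one of level \<open>- k - 2 >= 0\<close>.
    Conjugation by \<open>e^(k + 1)\<close> shifts these levels to \<open>k\<close> and -1.\<close>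
  have neg: "relabels (step e a k)" if k: "k \<le> - 2" for a k
  proof -
    have "commute (step e a (-1)) (step e b (- k - 2))" for b
      using nonneg[of "- k - 2" b] k by (simp add: relabels_iff)
    then have conj: "commute (lpow e (k + 1) @ step e b (- k - 2) @ inv_word (lpow e (k + 1)))
        (lpow e (k + 1) @ step e a (-1) @ inv_word (lpow e (k + 1)))" for b
      by (rule commute_conj[OF commute_sym])
    have shift: "lpow e j @ step e b i @ inv_word (lpow e j) \<approx> step e b (i + j)" for i j b
      using lpow_conj_add[of e j i "[(b, Black)]" "- i - 1" "- j"] by (simp add: step_def algebra_simps)
    have "commute (step e b (-1)) (step e a k)" for b
      using commute_cong[OF commute_sym[OF commute_cong[OF commute_sym[OF conj[of b]] shift]] shift] by (simp add: algebra_simps)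
    then show ?thesis by (simp add: relabels_iff)
  qed
  have "relabels (step e a k)" for a k
  proof -
    consider "k \<ge> 0" | "k = -1" | "k \<le> -2" by linarith
    then show ?thesis
      using nonneg neg H' by cases (auto simp: relabels_def minus_one)
  qed
  then show ?thesis
    using relabels_of_steps[of e 0 v] v by (simp add: relabels_Nil)
qed

end

text \<open>Blocks of \<open>q\<close> join points of equal name, and such points share a block of
  \<open>p\<close>. Hence a labelling with distinct names for the blocks determines the
  diagram.\<close>

lemma labelling_unique:
  assumes p: "labelling l u p" and q: "labelling l u q"
    and names: "\<And>x y. x \<in> points p \<Longrightarrow> y \<in> points p \<Longrightarrow> fst (letter_at l u x) = fst (letter_at l u y) \<Longrightarrow>
      \<exists>B\<in>blocks p. x \<in> B \<and> y \<in> B"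
  shows "q = p"
proof -
  have pts: "points q = points p" using labellingD(6)[OF p] labellingD(6)[OF q] by simp
  have sub: "{x, y} \<in> blocks p" if xy: "{x, y} \<in> blocks q" for x y
  proof -
    have pair: "x \<in> points p" "y \<in> points p" "letter_at l u y = inv_letter (letter_at l u x)"
      using labelling_pair[OF q xy] by (simp_all add: pts)
    then obtain B where B: "B \<in> blocks p" "x \<in> B" "y \<in> B" using names[of x y] by auto
    have "x \<noteq> y" using pair(3) by auto
    moreover obtain a b where "B = {a, b}" using labelling_block[OF p B(1)] by metis
    ultimately have "B = {x, y}" using B by auto
    then show ?thesis using B by simp
  qed
  have "blocks q \<subseteq> blocks p"
  proof
    fix B assume "B \<in> blocks q"
    then show "B \<in> blocks p" using labelling_block[OF q] sub by metis
  qed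
  moreover have "blocks p \<subseteq> blocks q"
  proof
    fix B assume B: "B \<in> blocks p"
    then obtain x y where xy: "B = {x, y}" "x \<in> points p" using labelling_block[OF p] by metis
    then obtain z where z: "{x, z} \<in> blocks q" using labelling_mate_exists[OF q] pts by metis
    then have "z = y" using labelling_mate_unique[OF p sub[OF z]] B xy by simp
    then show "B \<in> blocks q" using z xy by simp
  qed
  ultimately show ?thesis
    using labellingD(2,3)[OF p] labellingD(2,3)[OF q] by (cases p; cases q) auto
qed

section \<open>From trivial boundary words to membership in a category\<close>

context partition_category
begin

text \<open>If the first leg is black, the block is relabelled around \<open>u\<close>. If it is
  white, rotating the word turns it into a block around \<open>t @ s\<close> with the black leg
  first.\<close>

lemma relabels_pair:
  assumes relabels: "\<And>v. int w dvd balance (map snd v) \<Longrightarrow> relabels (v :: 'n letter list)"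
    and u: "int w dvd balance (map snd u)" and ts: "int w dvd balance (map snd (t @ s))"
  shows "s @ [(a, c)] @ u @ [(a, inv_color c)] @ t \<approx> [] \<longleftrightarrow>
    s @ [(b, c)] @ u @ [(b, inv_color c)] @ (t :: 'n letter list) \<approx> []"
proof -
  have "s @ [(b, c)] @ u @ [(b, inv_color c)] @ t \<approx> []"
    if *: "s @ [(a, c)] @ u @ [(a, inv_color c)] @ t \<approx> []" for a b :: 'n
  proof (cases c)
    case Black
    then show ?thesis
      using word_eq_trans[OF word_eq_cong[OF relabelsD[OF relabels[OF u], of b a], of s t]] * by simp
  next
    case White
    have "((a, Black) # (t @ s) @ [(a, White)]) @ u \<approx> []"
      using word_eq_Nil_rotate[of "s @ [(a, White)] @ u" "[(a, Black)] @ t"] * White by simp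
    then have "((b, Black) # (t @ s) @ [(b, White)]) @ u \<approx> []"
      using word_eq_trans[OF word_eq_append[OF relabelsD[OF relabels[OF ts], of b a] word_eq_refl[of u]]] by simp
    then show ?thesis
      using word_eq_Nil_rotate[of "[(b, Black)] @ t" "s @ [(b, White)] @ u"] White by simp
  qed
  then show ?thesis by blast
qed

definition rename_to :: "'n \<Rightarrow> 'n set \<Rightarrow> 'n letter list \<Rightarrow> 'n letter list" where
  "rename_to e A = map (map_prod (\<lambda>n. if n \<in> A then e else n) id)"

text \<open>Relabelling turns the boundary word into a one-letter word of balance 0, so the two
  labelled rows are related by some diagram of \<open>C\<close>. As the blocks had distinct names,
  it is the given one.\<close>

lemma S_cat_subset:
  assumes relabels: "\<And>v. int w dvd balance (map snd v) \<Longrightarrow> relabels (v :: point set letter list)"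
  shows "S_cat w \<subseteq> C"
proof
  fix p assume S: "p \<in> S_cat w"
  then have p: "p \<in> P2nb" and dvd: "enclosed_dvd w p (cyclic_points p)"
    by (simp_all add: S_cat_iff_enclosed_dvd)
  have part: "partition_on (points p) (blocks p)"
    using p by (simp add: P2nb_def pair_partition_def two_colored_partition_def)
  \<comment> \<open>Each point is named by its block; the union ranges over that block
    alone.\<close>
  define name where "name x = \<Union>{B \<in> blocks p. x \<in> B}" for x
  have name: "name x = B" if "B \<in> blocks p" "x \<in> B" for x B
  proof -
    have "{B \<in> blocks p. x \<in> B} = {B}"
      using that partition_onD2[OF part] by (auto dest: disjointD)
    then show ?thesis by (simp add: name_def)
  qed
  define l where "l = map (\<lambda>i. (name (Lo i), lower p ! i)) [0..<length (lower p)]"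
  define u where "u = map (\<lambda>i. (name (Up i), upper p ! i)) [0..<length (upper p)]"
  have letter: "letter_at l u x = (name x, normalized_color p x)" if "x \<in> points p" for x
    using that by (auto simp: points_def l_def u_def)
  have lab: "labelling l u p"
    unfolding labelling_def
  proof (intro conjI ballI)
    show "two_colored_partition p" using part by (simp add: two_colored_partition_def)
    show "map snd l = lower p" "map snd u = upper p" by (simp_all add: l_def u_def o_def map_nth)
    fix B assume B: "B \<in> blocks p"
    then obtain x y where xy: "B = {x, y}"
      using p by (auto simp: P2nb_def pair_partition_def card_2_iff)
    note P2nb_pair[OF p B[unfolded xy]]
    then have "letter_at l u y = inv_letter (letter_at l u x)"
      using letter name[OF B] xy by simp
    then show "\<exists>x y. B = {x, y} \<and> letter_at l u y = inv_letter (letter_at l u x)" using xy by blast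
  qed
  define W where "W = map (\<lambda>x. (name x, normalized_color p x)) (cyclic_points p)"
  have W: "W = l @ inv_word u"
  proof -
    have "W = map (letter_at l u) (cyclic_points p)"
      unfolding W_def by (rule map_cong) (simp_all add: letter)
    then show ?thesis using map_letter_at_cyclic_points[of l p u] by (simp add: l_def u_def)
  qed
  \<comment> \<open>The empty set serves as the fixed letter, as it is not a block.\<close>
  have rename: "rename_to {} A W \<approx> [] \<longleftrightarrow> W \<approx> []" if "finite A" "A \<subseteq> blocks p" for A
    using that
  proof (induction A)
    case empty
    show ?case by (simp add: rename_to_def map_prod_def)
  next
    \<comment> \<open>Merging the name of one more block into the fixed letter changes no colors, so
      the balances of all enclosed words persist.\<close>
    case (insert B A)
    then have B: "B \<in> blocks p" "B \<notin> A" by auto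
    have "rename_to {} (insert B A) W \<approx> [] \<longleftrightarrow> rename_to {} A W \<approx> []"
    proof -
      obtain s x us y t where xy: "B = {x, y}" and eq: "cyclic_points p = s @ x # us @ y # t"
        using P2nb_block_split[OF p B(1)] by metis
      have xy': "{x, y} \<in> blocks p" using B xy by simp
      have color: "normalized_color p y = inv_color (normalized_color p x)" using P2nb_pair(2)[OF p xy'] .
      have dist: "distinct (s @ x # us @ y # t)" using distinct_cyclic_points[of p] unfolding eq .
      have pts: "set (s @ x # us @ y # t) = points p" by (simp flip: eq)
      have other: "name z \<noteq> B" if "z \<in> set s \<union> set us \<union> set t" for z
      proof -
        have "z \<in> points p" using pts that by auto
        then have "z \<in> name z" using name partition_onD1[OF part] by auto
        moreover have "z \<notin> B" using dist that xy by auto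
        ultimately show ?thesis by auto
      qed
      define f where "f = map (\<lambda>z. (if name z \<in> A then {} else name z, normalized_color p z))"
      have snd_f: "map snd (f zs) = map (normalized_color p) zs" for zs by (simp add: f_def)
      have f_insert: "map (\<lambda>z. (if name z = B \<or> name z \<in> A then {} else name z, normalized_color p z)) zs = f zs"
        if "\<And>z. z \<in> set zs \<Longrightarrow> name z \<noteq> B" for zs
        using that by (auto simp: f_def)
      have nB: "name x = B" "name y = B" using name B xy by auto
      have "rename_to {} (insert B A) W = f s @ [({}, normalized_color p x)] @ f us @ [({}, inv_color (normalized_color p x))] @ f t"
        using f_insert[of s] f_insert[of us] f_insert[of t] other nB color
        unfolding rename_to_def W_def eq by (simp add: o_def)
      moreover have "rename_to {} A W = f s @ [(B, normalized_color p x)] @ f us @ [(B, inv_color (normalized_color p x))] @ f t"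
        using nB B(2) color unfolding rename_to_def W_def eq by (simp add: f_def o_def)
      moreover have us: "int w dvd balance (map snd (f us))"
        using dvd xy' eq unfolding snd_f enclosed_dvd_def by blast
      \<comment> \<open>The whole word and the two legs have balance zero, so inside and outside of
        the block have opposite balances.\<close>
      moreover have "balance (map snd (f t @ f s)) = - balance (map snd (f us))"
        using P2nb_balance(1)[OF p] color unfolding map_append snd_f eq by simp
      then have "int w dvd balance (map snd (f t @ f s))" using us by (simp only: dvd_minus_iff)
      ultimately show ?thesis using relabels_pair[OF relabels] by metis
    qed
    then show ?case using insert by auto
  qed
  have "finite (blocks p)" using finite_elements[OF finite_points part] .
  moreover have "rename_to {} (blocks p) W \<approx> []"
  proof -
    have "name x \<in> blocks p" if "x \<in> points p" for x
      using that name partition_onD1[OF part] by auto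
    then have "rename_to {} (blocks p) W = map (Pair {}) (map (normalized_color p) (cyclic_points p))"
      by (simp add: rename_to_def W_def)
    then show ?thesis
      using map_Pair_word_eq_lpow[of "{} :: point set" "map (normalized_color p) (cyclic_points p)"]
        P2nb_balance(1)[OF p] by simp
  qed
  ultimately have "W \<approx> []" using rename by blast
  then have "l \<approx> u" unfolding W using word_eq_iff_Nil by blast
  then obtain q where q: "q \<in> C" "labelling l u q" by (auto simp: word_eq_def)
  have "q = p"
  proof (rule labelling_unique[OF lab q(2)])
    fix x y assume "x \<in> points p" "y \<in> points p" "fst (letter_at l u x) = fst (letter_at l u y)"
    then show "\<exists>B\<in>blocks p. x \<in> B \<and> y \<in> B"
      using letter name partition_onD1[OF part] by (metis UnionE fst_conv)
  qed
  then show "p \<in> C" using q by simp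
qed

end

subsection \<open>The generators\<close>

text \<open>The two brackets are separate blocks and may carry different names. For
  \<open>c = Black\<close> the diagram thus expresses the relation
  \<open>a v a^-1 = b v b^-1\<close>.\<close>

lemma labelling_Br:
  fixes v :: "'n letter list"
  shows "labelling ((a, c) # v @ [(a, inv_color c)]) ((b, c) # v @ [(b, inv_color c)]) (Br c (Id_part (map snd v)))"
proof -
  define n where "n = length v"
  let ?l = "(a, c) # v @ [(a, inv_color c)]" and ?u = "(b, c) # v @ [(b, inv_color c)]"
  let ?p = "Br c (Id_part (map snd v))"
  have blocks: "blocks ?p = {{Lo (Suc i), Up (Suc i)} | i. i < n} \<union> {{Lo 0, Lo (Suc n)}, {Up 0, Up (Suc n)}}"
    by (simp add: Br_def Id_part_def n_def setcompr_eq_image image_image)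
  have points: "points ?p = Lo ` {..<Suc (Suc n)} \<union> Up ` {..<Suc (Suc n)}"
    by (simp add: points_def Br_def Id_part_def n_def)
  have "partition_on (points ?p) (blocks ?p)"
    unfolding blocks points
  proof (rule partition_onI)
    let ?P = "{{Lo (Suc i), Up (Suc i)} | i. i < n} \<union> {{Lo 0, Lo (Suc n)}, {Up 0, Up (Suc n)}}"
    have "Lo i \<in> \<Union> ?P \<and> Up i \<in> \<Union> ?P" if "i < Suc (Suc n)" for i
    proof (cases i)
      case (Suc j)
      show ?thesis
      proof (cases "j = n")
        case False
        then have "{Lo i, Up i} \<in> ?P" using that Suc by auto
        then show ?thesis by (meson UnionI insertI1 insertI2)
      qed (simp add: Suc)
    qed auto
    then show "\<Union> ?P = Lo ` {..<Suc (Suc n)} \<union> Up ` {..<Suc (Suc n)}"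
      by (intro equalityI subsetI) auto
  qed (auto simp: disjnt_def)
  moreover have "\<exists>x y. B = {x, y} \<and> letter_at ?l ?u y = inv_letter (letter_at ?l ?u x)" if "B \<in> blocks ?p" for B
    using that unfolding blocks
  proof (elim UnE)
    assume "B \<in> {{Lo (Suc i), Up (Suc i)} | i. i < n}"
    then obtain i where "i < n" "B = {Lo (Suc i), Up (Suc i)}" by auto
    then show ?thesis
      by (intro exI[of _ "Lo (Suc i)"] exI[of _ "Up (Suc i)"]) (simp add: nth_append n_def)
  next
    assume "B \<in> {{Lo 0, Lo (Suc n)}, {Up 0, Up (Suc n)}}"
    then show ?thesis
    proof (elim insertE)
      assume "B = {Lo 0, Lo (Suc n)}"
      then show ?thesis
        by (intro exI[of _ "Lo 0"] exI[of _ "Lo (Suc n)"]) (simp add: nth_append n_def)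
    next
      assume "B = {Up 0, Up (Suc n)}"
      then show ?thesis
        by (intro exI[of _ "Up 0"] exI[of _ "Up (Suc n)"]) (simp add: nth_append n_def)
    qed simp
  qed
  ultimately show ?thesis
    by (simp add: labelling_def two_colored_partition_def Br_def Id_part_def)
qed

text \<open>In the group, the crossing says that inverses of generators commute.\<close>

lemma labelling_crossing:
  "labelling [(a, White), (b, White)] [(b, White), (a, White)] crossing"
proof -
  have "partition_on (points crossing) (blocks crossing)"
    by (rule partition_onI) (auto simp: points_def crossing_def disjnt_def lessThan_Suc)
  then show ?thesis
    by (fastforce simp: labelling_def two_colored_partition_def crossing_def)
qed

lemma labelling_H_part:
  "labelling [(a, White), (c, Black), (b, White)] [(b, White), (c, Black), (a, White)] H_part"
proof -
  have "partition_on (points H_part) (blocks H_part)"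
    by (rule partition_onI) (auto simp: points_def H_part_def disjnt_def lessThan_Suc numeral_2_eq_2)
  then show ?thesis
    by (fastforce simp: labelling_def two_colored_partition_def H_part_def)
qed

text \<open>The legs of the lower bracket have levels 0 and \<open>balance cs mod w\<close>. These
  diagrams also tell the sets \<open>S_cat w\<close> apart.\<close>

lemma Br_Id_part_in_S_cat_iff: "Br Black (Id_part cs) \<in> S_cat w \<longleftrightarrow> int w dvd balance cs"
proof -
  let ?p = "Br Black (Id_part cs)"
  let ?l = "levels w 0 (Black # cs @ [White])"
  have rows: "lower ?p = Black # cs @ [White]" "upper ?p = Black # cs @ [White]"
    by (simp_all add: Br_def Id_part_def)
  have l: "?l = (0, Black) # levels w 1 cs @ [(balance cs mod int w, White)]"
    by simp
  show ?thesis
  proof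
    assume "int w dvd balance cs"
    then have "balance cs mod int w = 0" by simp
    then show "?p \<in> S_cat w"
      using labelling_Br[of 0 Black "levels w 1 cs" 0] unfolding S_cat_iff_labelling rows l by simp
  next
    assume "?p \<in> S_cat w"
    then have lab: "labelling ?l ?l ?p" unfolding S_cat_iff_labelling rows .
    have "{Lo 0, Lo (Suc (length cs))} \<in> blocks ?p" by (simp add: Br_def Id_part_def)
    from labelling_pair(1)[OF lab this] show "int w dvd balance cs"
      unfolding l by (simp add: nth_append dvd_eq_mod_eq_0)
  qed
qed

section \<open>Comparison of the sets \<open>S_cat w\<close>\<close>

lemma S_cat_mono: "w dvd w' \<Longrightarrow> S_cat w' \<subseteq> S_cat w"
proof
  fix p assume "w dvd w'" "p \<in> S_cat w'"
  then show "p \<in> S_cat w"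
    using dvd_trans[of "int w" "int w'"] unfolding S_cat_iff_enclosed_dvd enclosed_dvd_def
    by (simp only: int_dvd_int_iff) blast
qed

lemma S_cat_0_eq_Inter: "S_cat 0 = (\<Inter>w\<in>{1..}. S_cat w)"
proof
  show "S_cat 0 \<subseteq> (\<Inter>w\<in>{1..}. S_cat w)" using S_cat_mono[of _ 0] by auto
  \<comment> \<open>Tested with \<open>w = abs z + 1\<close>, which is too large to divide a nonzero
    \<open>z\<close>.\<close>
  have zero: "z = 0" if "\<And>w. w \<ge> 1 \<Longrightarrow> int w dvd z" for z
    using that[of "nat \<bar>z\<bar> + 1"] zdvd_not_zless[of "\<bar>z\<bar>" "1 + \<bar>z\<bar>"] by (cases "z = 0") auto
  show "(\<Inter>w\<in>{1..}. S_cat w) \<subseteq> S_cat 0"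
  proof
    fix p assume "p \<in> (\<Inter>w\<in>{1..}. S_cat w)"
    then have *: "p \<in> P2nb" "\<And>w. w \<ge> 1 \<Longrightarrow> enclosed_dvd w p (cyclic_points p)"
      by (auto simp: S_cat_iff_enclosed_dvd)
    have "enclosed_dvd 0 p (cyclic_points p)"
      unfolding enclosed_dvd_def
    proof (intro allI impI)
      fix s x us y t assume "cyclic_points p = s @ x # us @ y # t" "{x, y} \<in> blocks p"
      then have "\<And>w. w \<ge> 1 \<Longrightarrow> int w dvd balance (map (normalized_color p) us)"
        using *(2) unfolding enclosed_dvd_def by blast
      then show "int 0 dvd balance (map (normalized_color p) us)" using zero by simp
    qed
    then show "p \<in> S_cat 0" using * by (simp add: S_cat_iff_enclosed_dvd)
  qed
qed

lemma S_cat_inj: "S_cat w = S_cat w' \<Longrightarrow> w = w'"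
proof -
  assume eq: "S_cat w = S_cat w'"
  \<comment> \<open>The bracket around \<open>v'\<close> white points lies in
    \<open>S_cat v'\<close>, and it lies in \<open>S_cat v\<close> only if \<open>v\<close> divides
    \<open>v'\<close>.\<close>
  have "int v dvd int v'" if "S_cat v = S_cat v'" for v v'
    using Br_Id_part_in_S_cat_iff[of "replicate v' White" v'] Br_Id_part_in_S_cat_iff[of "replicate v' White" v] that
    by (simp add: sum_list_replicate)
  from this[OF eq] this[OF eq[symmetric]] show "w = w'"
    by (simp add: dvd_antisym)
qed

section \<open>Generating sets\<close>

lemma S_cat_eq_generated:
  assumes "G \<subseteq> S_cat w" "\<And>C. category C \<Longrightarrow> G \<subseteq> C \<Longrightarrow> S_cat w \<subseteq> C"
  shows "S_cat w = generated_category G"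
proof
  show "S_cat w \<subseteq> generated_category G"
    unfolding generated_category_def by (rule Inter_greatest) (simp add: assms(2))
  show "generated_category G \<subseteq> S_cat w"
    unfolding generated_category_def by (rule Inter_lower) (simp add: assms(1) category_S_cat)
qed

text \<open>The bracket relation holds for all names of the \<open>w\<close> enclosed white letters,
  as \<open>relabels_of_whites\<close> demands.\<close>

lemma S_cat_eq_generated_Br:
  assumes w: "w \<ge> 1"
  shows "S_cat w = generated_category {Br Black (Id_part (replicate w White))}"
proof (rule S_cat_eq_generated)
  show "{Br Black (Id_part (replicate w White))} \<subseteq> S_cat w"
    by (simp add: Br_Id_part_in_S_cat_iff sum_list_replicate)
  fix C assume C: "category C" "{Br Black (Id_part (replicate w White))} \<subseteq> C"
  interpret partition_category C by unfold_locales (rule C)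
  have "relabels (map (\<lambda>n. (n, White)) ns)" if "length ns = w" for ns :: "point set list"
  proof (rule relabelsI)
    fix a b :: "point set"
    have "map snd (map (\<lambda>n. (n, White)) ns) = replicate w White"
      using that by (simp add: o_def map_replicate_const)
    then show "word_eq ((a, Black) # map (\<lambda>n. (n, White)) ns @ [(a, White)]) ((b, Black) # map (\<lambda>n. (n, White)) ns @ [(b, White)])"
      using labelling_Br[of a Black "map (\<lambda>n. (n, White)) ns" b] C(2) by (auto simp: word_eq_def)
  qed
  then show "S_cat w \<subseteq> C"
    using S_cat_subset relabels_of_whites[OF w] by blast
qed

lemma S_cat_1_eq_generated_crossing: "S_cat 1 = generated_category {crossing}"
proof (rule S_cat_eq_generated)
  show "{crossing} \<subseteq> S_cat 1"
  proof -
    have rows: "lower crossing = [White, White]" "upper crossing = [White, White]"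
      by (simp_all add: crossing_def)
    show ?thesis
      unfolding insert_subset S_cat_iff_labelling rows using labelling_crossing[of 0 0] by simp
  qed
  fix C assume C: "category C" "{crossing} \<subseteq> C"
  interpret partition_category C by unfold_locales (rule C)
  have white: "commute [(n, White)] [(b, White)]" for n b :: "point set"
    using C(2) labelling_crossing[of n b] by (auto simp: commute_def word_eq_def)
  have "relabels (map (\<lambda>n. (n, White)) ns)" if ns: "length ns = 1" for ns :: "point set list"
  proof -
    obtain n where n: "ns = [n]" using ns by (auto simp: length_Suc_conv)
    \<comment> \<open>The word \<open>b^-1 a\<close> is a white letter times the inverse of a white
      letter, and white letters commute by the crossing.\<close>
    have "commute [(n, White)] ([(b, White)] @ inv_word [(a, White)])" for a b
      by (intro commute_append commute_inv white)
    then show ?thesis by (simp add: n relabels_def commute_sym)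
  qed
  then show "S_cat 1 \<subseteq> C"
    using S_cat_subset relabels_of_whites[OF order_refl] by blast
qed

lemma S_cat_0_eq_generated:
  "S_cat 0 = generated_category
     ({H_part} \<union> {Br Black (Id_part (replicate v Black @ replicate v White)) | v. v \<ge> 1})"
  (is "_ = generated_category ?G")
proof (rule S_cat_eq_generated)
  have "H_part \<in> S_cat 0"
  proof -
    have rows: "lower H_part = [White, Black, White]" "upper H_part = [White, Black, White]"
      by (simp_all add: H_part_def)
    show ?thesis
      \<comment> \<open>The path goes down, up and down, and all three steps have lower end
        -1.\<close>
      unfolding S_cat_iff_labelling rows using labelling_H_part[of "-1" "-1" "-1"] by simp
  qed
  then show "?G \<subseteq> S_cat 0"
    by (auto simp: Br_Id_part_in_S_cat_iff sum_list_replicate)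
  fix C assume C: "category C" "?G \<subseteq> C"
  interpret partition_category C by unfold_locales (rule C)
  have H: "word_eq [(a, White), (c, Black), (b, White)] [(b, White), (c, Black), (a, White)]" for a b c :: "point set"
    using C(2) labelling_H_part[of a c b] by (auto simp: word_eq_def)
  \<comment> \<open>Letters inside a bracket may be named arbitrarily, so the generators yield all
    mountains and not only those over one name.\<close>
  have mountains: "relabels (map (\<lambda>n. (n, Black)) ms @ map (\<lambda>n. (n, White)) ns)"
    if "length ms = length ns" "ms \<noteq> []" for ms ns :: "point set list"
  proof (rule relabelsI)
    fix a b :: "point set"
    let ?v = "map (\<lambda>n. (n, Black)) ms @ map (\<lambda>n. (n, White)) ns"
    have "map snd ?v = replicate (length ms) Black @ replicate (length ms) White"
      using that by (simp add: o_def map_replicate_const)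
    moreover have "length ms \<ge> 1" using that by (cases ms) auto
    ultimately have "Br Black (Id_part (map snd ?v)) \<in> C" using C(2) by auto
    then show "word_eq ((a, Black) # ?v @ [(a, White)]) ((b, Black) # ?v @ [(b, White)])"
      using labelling_Br[of a Black ?v b] unfolding word_eq_def by auto
  qed
  have "relabels v" if "int 0 dvd balance (map snd v)" for v :: "point set letter list"
    by (rule relabels_of_mountains) (use mountains H that in auto)
  then show "S_cat 0 \<subseteq> C" by (rule S_cat_subset)
qed

theorem theorem1:
  shows
    "(\<forall>w. category (S_cat w))
     \<and>
     ((\<forall>w w'. w \<noteq> w' \<longrightarrow> S_cat w \<noteq> S_cat w') \<and>
      (\<forall>w\<ge>1. S_cat 0 = (\<Inter>w'\<in>{1..}. S_cat w') \<and>
              (\<Inter>w'\<in>{1..}. S_cat w') \<subseteq> S_cat w \<and>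
              S_cat w \<subseteq> S_cat 1 \<and>
              S_cat 1 = generated_category {crossing}) \<and>
      (\<forall>w\<ge>1. \<forall>w'\<ge>1. int_multiples w' \<subseteq> int_multiples w \<longrightarrow> S_cat w' \<subseteq> S_cat w))
     \<and>
     ((\<forall>w\<ge>1. S_cat w = generated_category {Br Black (Id_part (replicate w White))}) \<and>
      S_cat 0 = generated_category
        ({H_part} \<union> {Br Black (Id_part (replicate v Black @ replicate v White)) | v. v \<ge> 1}))"
proof (intro conjI allI impI)
  fix w :: nat
  show "category (S_cat w)" by (rule category_S_cat)
  show "S_cat w \<noteq> S_cat w'" if "w \<noteq> w'" for w'
    using S_cat_inj that by blast
  show "S_cat 0 = (\<Inter>w'\<in>{1..}. S_cat w')" by (rule S_cat_0_eq_Inter)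
  show "(\<Inter>w'\<in>{1..}. S_cat w') \<subseteq> S_cat w" if "w \<ge> 1" using that by auto
  show "S_cat w \<subseteq> S_cat 1" by (rule S_cat_mono) simp
  show "S_cat 1 = generated_category {crossing}" by (rule S_cat_1_eq_generated_crossing)
  show "S_cat w' \<subseteq> S_cat w" if "int_multiples w' \<subseteq> int_multiples w" for w'
  proof (rule S_cat_mono)
    have "int w' \<in> int_multiples w'" by (simp add: int_multiples_iff)
    then have "int w' \<in> int_multiples w" using that by (rule subsetD[rotated])
    then show "w dvd w'" by (simp add: int_multiples_iff)
  qed
  show "S_cat w = generated_category {Br Black (Id_part (replicate w White))}" if "w \<ge> 1"
    using that by (rule S_cat_eq_generated_Br)
qed (rule S_cat_0_eq_generated)

end
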